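(* Let $c\ge0$ be a fixed integer (with $c\in\{0,1,\dots,(p-3)/2\}$ for the primes $p$ considered). If $g\ge3$, then both $\mathfrak e_g^{(2c)}$ and $\mathfrak o_g^{(2c)}$ are polynomials of degree $3g-3$ in $p$ with leading coefficient $\left(c+\frac12\right)\widetilde B_{g-1}$.
   Context: Bernoulli numbers are defined by $\frac{t}{e^t-1}=\sum_{n\ge0}B_n\frac{t^n}{n!}$, and $\widetilde B_n=\frac12\frac{(-1)^{n+1}B_{2n}}{(2n)!}=\frac{\zeta(2n)}{(2\pi)^{2n}}$. Let $p\ge5$ be a prime, $d=(p-1)/2$, $0\le c\le d-1$. The lollipop tree $T_g^{(2c)}$ is the trivalent graph consisting of $g$ loops, the $i$-th loop attached to a stick edge, the sticks being attached successively to a spine ending in a free trunk edge colored $2c$. Its (small admissible) colorings are the families of integers $(a_1,\dots,a_g;\,l_1,\dots,l_g;\,k_0,\dots,k_g)$ (stick colors $2a_i$, loop colors $l_i$, spine colors $2k_i$) with $k_0=0$, $k_g=c$, such that for every $i=1,\dots,g$: $0\le a_i\le l_i\le d-1$, $|k_{i-1}-a_i|\le k_i\le k_{i-1}+a_i$, and $k_{i-1}+a_i+k_i\le 2d-1$ (with all $0\le k_i\le d-1$). (Here $k_1=a_1$: sticks 1 and 2 meet at the first vertex; edges colored $0$ may be erased.) A coloring is even or odd according as $c+\sum_{i=1}^g a_i$ is even or odd. Let $\mathfrak e_g^{(2c)}$ and $\mathfrak o_g^{(2c)}$ be the numbers of even and odd colorings respectively; for fixed $g,c$ they are functions of the prime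 $p\geq 5$ with $p\ge 2c+3$, and "polynomial in $p$" means that these functions are given by a polynomial with rational coefficients. *)

theory Defs
  imports
    "HOL-Library.FuncSet"
    "HOL-Computational_Algebra.Computational_Algebra"
begin

definition bernoulli_number :: "nat \<Rightarrow> rat" where
  "bernoulli_number n = fact n * fps_nth (fps_X / (fps_exp 1 - 1)) n"

text \<open>Since \<open>exp t - 1\<close> is not a unit, the quotient defining the Bernoulli numbers is the
  truncating division of formal power series; the division is exact.\<close>

lemma bernoulli_number_gf:
  "Abs_fps (\<lambda>n. bernoulli_number n / fact n) * (fps_exp 1 - 1) = fps_X"
proof -
  have gf: "Abs_fps (\<lambda>n. bernoulli_number n / fact n) = fps_X / (fps_exp 1 - 1)"
    by (rule fps_ext) (simp add: bernoulli_number_def)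
  have nth1: "fps_nth (fps_exp (1::rat) - 1) 1 = 1"
    by simp
  then have nz: "fps_exp (1::rat) - 1 \<noteq> 0"
    by (metis fps_zero_nth zero_neq_one)
  have "subdegree (fps_exp (1::rat) - 1) = 1"
    by (rule subdegreeI) (use nth1 in simp_all)
  then have "(fps_exp (1::rat) - 1) dvd fps_X"
    using nz by (simp add: fps_dvd_iff)
  then show ?thesis
    unfolding gf by simp
qed

definition bernoulli_tilde :: "nat \<Rightarrow> rat" where
  "bernoulli_tilde n = 1 / 2 * ((- 1) ^ (n + 1) * bernoulli_number (2 * n) / fact (2 * n))"

text \<open>A coloring of the lollipop tree with \<open>g\<close> loops and trunk color \<open>2 * c\<close>, where
  \<open>d = (p - 1) / 2\<close>, is a triple \<open>(a, l, k)\<close>: stick \<open>i\<close> has color \<open>2 * a i\<close>, loop \<open>i\<close> has color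
  \<open>l i\<close>, and the spine edges have colors \<open>2 * k i\<close>. The families are indexed by \<open>{1..g}\<close>,
  respectively \<open>{0..g}\<close>; extensionality fixes the functions outside the index set, so that
  distinct triples are distinct colorings.\<close>

definition lollipop_colorings ::
    "nat \<Rightarrow> nat \<Rightarrow> nat \<Rightarrow> ((nat \<Rightarrow> int) \<times> (nat \<Rightarrow> int) \<times> (nat \<Rightarrow> int)) set" where
  "lollipop_colorings p g c =
    (let d = (int p - 1) div 2 in
     {(a, l, k).
        a \<in> extensional {1..g} \<and> l \<in> extensional {1..g} \<and> k \<in> extensional {0..g} \<and>
        k 0 = 0 \<and> k g = int c \<and>
        (\<forall>i\<in>{0..g}. 0 \<le> k i \<and> k i \<le> d - 1) \<and>
        (\<forall>i\<in>{1..g}.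
           0 \<le> a i \<and> a i \<le> l i \<and> l i \<le> d - 1 \<and>
           \<bar>k (i - 1) - a i\<bar> \<le> k i \<and> k i \<le> k (i - 1) + a i \<and>
           k (i - 1) + a i + k i \<le> 2 * d - 1)})"

lemma finite_lollipop_colorings: "finite (lollipop_colorings p g c)"
proof -
  define D where "D = {0..(int p - 1) div 2 - 1}"
  have "lollipop_colorings p g c \<subseteq>
      ({1..g} \<rightarrow>\<^sub>E D) \<times> ({1..g} \<rightarrow>\<^sub>E D) \<times> ({0..g} \<rightarrow>\<^sub>E D)"
    unfolding lollipop_colorings_def Let_def D_def PiE_def Pi_def by fastforce
  moreover have "finite (({1..g} \<rightarrow>\<^sub>E D) \<times> ({1..g} \<rightarrow>\<^sub>E D) \<times> ({0..g} \<rightarrow>\<^sub>E D))"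
    unfolding D_def by (intro finite_cartesian_product finite_PiE) auto
  ultimately show ?thesis
    by (rule finite_subset)
qed

definition num_even_colorings :: "nat \<Rightarrow> nat \<Rightarrow> nat \<Rightarrow> nat" where
  "num_even_colorings p g c =
    card {(a, l, k) \<in> lollipop_colorings p g c. even (int c + (\<Sum>i = 1..g. a i))}"

definition num_odd_colorings :: "nat \<Rightarrow> nat \<Rightarrow> nat \<Rightarrow> nat" where
  "num_odd_colorings p g c =
    card {(a, l, k) \<in> lollipop_colorings p g c. odd (int c + (\<Sum>i = 1..g. a i))}"

end

theory Submission
  imports Defs
begin

text \<open>
  The sticks of a coloring carry spins \<open>a\<^sub>i\<close>, and the spine is a path
  \<open>0 = k\<^sub>0, k\<^sub>1, \<dots>, k\<^sub>g = c\<close> whose steps are allowed by the truncated Clebsch-Gordan rule.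
  Hence colorings are counted by the \<open>g\<close>-th power of a transfer matrix on \<open>{0, \<dots>, d - 1}\<close>,
  a stick of spin \<open>a\<close> entering with weight \<open>d - a\<close> (the number of colors left for its loop), and
  with the sign \<open>(-1)\<^sup>a\<close> if one wants the difference of even and odd colorings instead of their
  sum.  The transfer matrices for the various \<open>a\<close> are fusion matrices.  They have common
  eigenvectors \<open>k \<mapsto> sin ((2 k + 1) \<theta>)\<close> with \<open>\<theta> = \<pi> j / p\<close>, and the weighted sums have the
  eigenvalues \<open>p / (4 sin\<^sup>2 \<theta>)\<close> and, in the signed case, \<open>1 / (4 cos\<^sup>2 \<theta>)\<close>
  (\<open>weighted_count_eq\<close>, \<open>loop_eigenvalue_unsigned\<close>, \<open>loop_eigenvalue_signed\<close>).  All of this is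
  phrased with \<open>w = exp (2 \<i> \<theta>)\<close> running through the \<open>p\<close>-th roots of unity.

  Since \<open>sin \<theta> sin ((2 c + 1) \<theta>)\<close> is a polynomial in \<open>sin\<^sup>2 \<theta>\<close> or in \<open>cos\<^sup>2 \<theta>\<close>, both
  weighted counts are combinations of the power sums
  \<open>S\<^sub>m(n) = \<Sum> sin\<^bsup>-2m\<^esup>(\<pi> j / n)\<close>, \<open>0 < j < n\<close>; the sums of \<open>cos\<^bsup>-2m\<^esup>\<close> are
  \<open>S\<^sub>m(2p) - S\<^sub>m(p)\<close>.  For \<open>m \<le> 0\<close> the sum \<open>S\<^sub>m(n)\<close> is linear in \<open>n > -m\<close>.  For \<open>m > 0\<close> the
  generating function is \<open>1 - \<Sum>\<^sub>m S\<^sub>m(n) x\<^sup>m = n cot (n t) tan t\<close> where \<open>x = sin\<^sup>2 t\<close>.  As the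
  cotangent satisfies a Riccati equation, so does this series in \<open>x\<close> (\<open>csc_gf_riccati\<close>), which
  amounts to a quadratic recursion whose coefficients are polynomials in \<open>n\<close>.  So \<open>S\<^sub>m(n)\<close> is a
  polynomial of degree \<open>2 m\<close> in \<open>n\<close>, and comparison of the top coefficients with the Riccati
  equation of \<open>t / (e\<^sup>t - 1) + t / 2\<close> identifies the leading one as \<open>2 \<cdot> 4\<^sup>m\<close> times the
  normalized Bernoulli number (\<open>csc_power_sum_poly\<close>).

  The unsigned count therefore has degree \<open>(g - 1) + 2 (g - 1)\<close>, while the signed one has degree
  at most \<open>2 g - 1\<close>, because \<open>S\<^sub>m(2p) - S\<^sub>m(p)\<close> is divisible by \<open>p\<close>.  For \<open>g \<ge> 3\<close> this is
  smaller, so that even and odd colorings are both half of the unsigned count to leading order.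
\<close>

section \<open>Power sums of squared sines at roots of unity\<close>

definition unity_roots :: "nat \<Rightarrow> complex set" where
  "unity_roots n = {w. w ^ n = 1}"

lemma finite_unity_roots [simp]: "n > 0 \<Longrightarrow> finite (unity_roots n)"
  unfolding unity_roots_def by (rule finite_roots_unity) simp

lemma one_in_unity_roots [simp]: "1 \<in> unity_roots n"
  by (simp add: unity_roots_def)

lemma unity_roots_nonzero: "w \<in> unity_roots n \<Longrightarrow> n > 0 \<Longrightarrow> w \<noteq> 0"
  by (auto simp: unity_roots_def power_0_left)

lemma card_unity_roots [simp]: "n > 0 \<Longrightarrow> card (unity_roots n) = n"
  unfolding unity_roots_def by (rule card_roots_unity_eq)

lemma inverse_unity_roots: "w \<in> unity_roots n \<Longrightarrow> inverse w \<in> unity_roots n"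
  by (auto simp: unity_roots_def power_inverse)

lemma sum_unity_roots_inverse:
  "(\<Sum>w\<in>unity_roots n. f (inverse w)) = (\<Sum>w\<in>unity_roots n. f w)"
  by (rule sum.reindex_bij_witness[of _ inverse inverse]) (auto simp: inverse_unity_roots)

text \<open>Multiplication by the primitive root permutes the roots of unity and multiplies the
  sum by a factor different from \<open>1\<close>.\<close>

lemma sum_unity_roots_power:
  assumes "0 < k" "k < n"
  shows "(\<Sum>w\<in>unity_roots n. w ^ k) = 0"
proof -
  define z where "z = cis (2 * pi / n)"
  have zn: "z ^ n = 1" using assms by (simp add: z_def Complex.DeMoivre)
  have z0: "z \<noteq> 0" by (simp add: z_def)
  have zk: "z ^ k \<noteq> 1"
  proof
    assume a: "z ^ k = 1"
    have inj: "inj_on (\<lambda>k. cis (2 * pi * real k / real n)) {..<n}"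
      using bij_betw_roots_unity[of n] assms by (simp add: bij_betw_def)
    have "cis (2 * pi * real k / real n) = cis (2 * pi * real 0 / real n)"
      using a by (simp add: z_def Complex.DeMoivre mult_ac)
    hence "k = 0" using inj_onD[OF inj, of k 0] assms by simp
    thus False using assms by simp
  qed
  have "(\<Sum>w\<in>unity_roots n. w ^ k) = (\<Sum>w\<in>unity_roots n. (z * w) ^ k)"
    by (rule sum.reindex_bij_witness[of _ "\<lambda>w. z * w" "\<lambda>w. w / z"])
       (use z0 zn in \<open>auto simp: unity_roots_def power_mult_distrib power_divide\<close>)
  also have "\<dots> = z ^ k * (\<Sum>w\<in>unity_roots n. w ^ k)"
    by (simp add: power_mult_distrib sum_distrib_left)
  finally show ?thesis using zk by simp
qed

lemma sum_unity_roots_power_int: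
  assumes "\<bar>k\<bar> < int n"
  shows "(\<Sum>w\<in>unity_roots n. w powi k) = (if k = 0 then of_nat n else 0)"
proof -
  have pos: "(\<Sum>w\<in>unity_roots n. w powi k) = 0" if "0 < k" "k < int n" for k
    using sum_unity_roots_power[of "nat k" n] that by (simp add: power_int_def)
  consider "k = 0" | "0 < k" | "k < 0" by linarith
  then show ?thesis
  proof cases
    case 3
    have "(\<Sum>w\<in>unity_roots n. w powi k) = (\<Sum>w\<in>unity_roots n. (inverse w) powi k)"
      by (rule sum_unity_roots_inverse[symmetric])
    also have "\<dots> = (\<Sum>w\<in>unity_roots n. w powi (- k))"
      by (simp add: power_int_inverse power_int_minus)
    also have "\<dots> = 0" by (rule pos) (use 3 assms in auto)
    finally show ?thesis using 3 by simp
  qed (use assms pos in auto)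
qed

text \<open>For \<open>w = exp (2 \<i> \<theta>)\<close> this is \<open>sin\<^sup>2 \<theta>\<close>; hence the value at \<open>- w\<close> is \<open>cos\<^sup>2 \<theta>\<close>.\<close>

definition half_sin_sq :: "complex \<Rightarrow> complex" where
  "half_sin_sq w = (2 - w - inverse w) / 4"

text \<open>The sum of \<open>sin\<^bsup>-2m\<^esup>(\<pi> j / n)\<close> over \<open>0 < j < n\<close>.  The exponent is an integer, since low powers
  of the sine also occur in the counting formula.\<close>

definition csc_power_sum :: "int \<Rightarrow> nat \<Rightarrow> complex" where
  "csc_power_sum m n = (\<Sum>w\<in>unity_roots n - {1}. half_sin_sq w powi (- m))"

lemma half_sin_sq_eq_0_iff: "w \<noteq> 0 \<Longrightarrow> half_sin_sq w = 0 \<longleftrightarrow> w = 1"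
proof -
  assume w: "w \<noteq> 0"
  have "half_sin_sq w = - ((w - 1)\<^sup>2 / (4 * w))"
    using w by (simp add: half_sin_sq_def field_simps power2_eq_square)
  thus ?thesis using w by simp
qed

lemma half_sin_sq_1 [simp]: "half_sin_sq 1 = 0"
  by (simp add: half_sin_sq_def)

section \<open>The Riccati equation of the generating function\<close>

lemma fps_const_sum_eq: "fps_const (\<Sum>x\<in>A. g x) = (\<Sum>x\<in>A. fps_const (g x))"
  by (rule fps_ext) (simp add: fps_sum_nth)

text \<open>In closed form this is \<open>n cot (n t) tan t\<close> as a series in \<open>sin\<^sup>2 t\<close>.  The closed form is
  proved formally, in the parameter \<open>X = exp (2 \<i> t) - 1\<close>.\<close>

definition csc_gf :: "nat \<Rightarrow> complex fps" where
  "csc_gf n = 1 - Abs_fps (\<lambda>m. if m = 0 then 0 else csc_power_sum (int m) n)"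

text \<open>The formal counterpart of \<open>exp (2 \<i> t)\<close>, expanded at \<open>t = 0\<close>.\<close>

definition exp_param :: "complex fps" where "exp_param = 1 + fps_X"

lemma exp_param_nth_0 [simp]: "fps_nth exp_param 0 = 1"
  by (simp add: exp_param_def)

lemma exp_param_deriv [simp]: "fps_deriv exp_param = 1"
  by (simp add: exp_param_def)

lemma exp_param_minus_const_nonzero: "exp_param - fps_const a \<noteq> 0"
proof
  assume "exp_param - fps_const a = 0"
  hence "fps_nth (exp_param - fps_const a) 1 = 0" by simp
  thus False by (simp add: exp_param_def)
qed

text \<open>The formal counterpart of \<open>sin\<^sup>2 t\<close>, to be substituted for the variable of \<open>csc_gf\<close>.\<close>

definition sin_sq_param :: "complex fps" where
  "sin_sq_param = fps_const (1/4) * (2 - exp_param - inverse exp_param)"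

lemma exp_param_inverse: "exp_param * inverse exp_param = 1"
  by (rule inverse_mult_eq_1') simp

lemma sin_sq_param_eq: "4 * exp_param * sin_sq_param = - (exp_param - 1)\<^sup>2"
proof -
  have "4 * exp_param * sin_sq_param =
      (4 * fps_const (1/4)) * (2 * exp_param - exp_param * exp_param - exp_param * inverse exp_param)"
    unfolding sin_sq_param_def by (simp add: algebra_simps)
  also have "(4::complex fps) * fps_const (1/4) = 1" by (simp add: numeral_fps_const)
  finally show ?thesis using exp_param_inverse by algebra
qed

lemma sin_sq_param_nth_0 [simp]: "fps_nth sin_sq_param 0 = 0"
  by (simp add: sin_sq_param_def)

lemma sin_sq_param_nonzero: "sin_sq_param \<noteq> 0"
proof
  assume "sin_sq_param = 0"
  with sin_sq_param_eq have "(exp_param - 1)\<^sup>2 = 0" by simp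
  thus False using exp_param_minus_const_nonzero[of 1] by simp
qed

text \<open>With \<open>y = exp (2 \<i> t)\<close> the summand of a root \<open>w\<close> is the geometric series
  \<open>x / (s - x) = - (y - 1)\<^sup>2 / ((y - w) (y - w\<^bsup>-1\<^esup>))\<close>, where \<open>s = half_sin_sq w\<close>.  Its partial
  fraction decomposition has the denominators \<open>y - w\<close> and \<open>y - w\<^bsup>-1\<^esup>\<close>, and multiplication by
  \<open>y\<^sup>n - 1\<close> turns \<open>1 / (y - w)\<close> into the polynomial \<open>q w\<close>.\<close>

lemma csc_summand_compose:
  fixes w :: complex
  assumes w: "w \<noteq> 0" "w \<noteq> 1" "w ^ n = 1"
  defines "f \<equiv> Abs_fps (\<lambda>m. if m = 0 then 0 else half_sin_sq w powi (- int m))"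
  defines "q \<equiv> (\<lambda>w. \<Sum>k<n. fps_const (w ^ k) * exp_param ^ (n - Suc k))"
  shows "(f oo sin_sq_param) * ((exp_param + 1) * (exp_param ^ n - 1)) =
         - (exp_param - 1) * (exp_param * q w + fps_const (inverse w) * q (inverse w))"
proof -
  define v where "v = inverse w"
  have v: "v ^ n = 1" "w * v = 1" using w by (auto simp: v_def power_inverse)
  have s0: "half_sin_sq w \<noteq> 0" using half_sin_sq_eq_0_iff w by blast
  \<comment> \<open>\<open>f\<close> is the geometric series \<open>X / (s - X)\<close>.\<close>
  have "f * (fps_const (half_sin_sq w) - fps_X) = fps_X"
  proof (rule fps_ext)
    fix k
    show "fps_nth (f * (fps_const (half_sin_sq w) - fps_X)) k = fps_nth fps_X k"
    proof (cases k)
      case (Suc j)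
      have "f $ Suc j * half_sin_sq w = (if j = 0 then 1 else f $ j)"
        using s0 power_int_add_1[of "half_sin_sq w" "- int (Suc j)"] by (simp add: f_def)
      then show ?thesis using Suc by (simp add: algebra_simps f_def)
    qed (simp add: f_def)
  qed
  hence "(f * (fps_const (half_sin_sq w) - fps_X)) oo sin_sq_param = sin_sq_param" by simp
  hence e1: "(f oo sin_sq_param) * (fps_const (half_sin_sq w) - sin_sq_param) = sin_sq_param"
    by (simp add: fps_compose_mult_distrib fps_compose_sub_distrib)
  have hs: "4 * fps_const (half_sin_sq w) = 2 - fps_const w - fps_const v"
    by (simp add: half_sin_sq_def v_def numeral_fps_const)
  have wv: "fps_const w * fps_const v = 1" using v by simp
  have "4 * exp_param * (fps_const (half_sin_sq w) - sin_sq_param) =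
     exp_param * (4 * fps_const (half_sin_sq w)) - 4 * exp_param * sin_sq_param"
    by (simp add: algebra_simps)
  also have "\<dots> = exp_param * (2 - fps_const w - fps_const v) + (exp_param - 1)\<^sup>2"
    by (simp only: hs sin_sq_param_eq diff_minus_eq_add)
  also have "\<dots> = (exp_param - fps_const w) * (exp_param - fps_const v)"
    using wv by algebra
  finally have e2: "4 * exp_param * (fps_const (half_sin_sq w) - sin_sq_param) =
    (exp_param - fps_const w) * (exp_param - fps_const v)" .
  have "(f oo sin_sq_param) * ((exp_param - fps_const w) * (exp_param - fps_const v)) =
     4 * exp_param * ((f oo sin_sq_param) * (fps_const (half_sin_sq w) - sin_sq_param))"
    unfolding e2[symmetric] by algebra
  also have "\<dots> = - (exp_param - 1)\<^sup>2" unfolding e1 by (rule sin_sq_param_eq)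
  finally have e3: "(f oo sin_sq_param) * ((exp_param - fps_const w) * (exp_param - fps_const v)) =
      - (exp_param - 1)\<^sup>2" .
  have q: "(exp_param - fps_const u) * q u = exp_param ^ n - 1" if "u ^ n = 1" for u
  proof -
    have "exp_param ^ n - fps_const u ^ n = - (fps_const u ^ n - exp_param ^ n)" by simp
    also have "\<dots> = - ((fps_const u - exp_param) * (\<Sum>i<n. exp_param ^ (n - Suc i) * fps_const u ^ i))"
      by (simp only: power_diff_sumr2)
    also have "\<dots> = (exp_param - fps_const u) * (\<Sum>i<n. exp_param ^ (n - Suc i) * fps_const u ^ i)"
      by (simp only: minus_diff_eq flip: mult_minus_left)
    finally have "exp_param ^ n - fps_const u ^ n =
      (exp_param - fps_const u) * (\<Sum>i<n. exp_param ^ (n - Suc i) * fps_const u ^ i)" .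
    moreover have "fps_const u ^ n = 1" using that by (simp add: fps_const_power)
    ultimately show ?thesis by (simp add: q_def fps_const_power mult.commute)
  qed
  have qw: "(exp_param - fps_const w) * q w =
      exp_param ^ n - 1" and qv: "(exp_param - fps_const v) * q v = exp_param ^ n - 1"
    using q w v by auto
  let ?P = "(exp_param - fps_const w) * (exp_param - fps_const v)"
  have alg: "((y - a) * (y - b)) * (F * ((y + 1) * (Y - 1))) =
      ((y - a) * (y - b)) * (- (y - 1) * (y * Q + b * R))"
    if "F * ((y - a) * (y - b)) = - (y - 1)\<^sup>2" "(y - a) * Q = Y - 1" "(y - b) * R = Y - 1" "a * b = 1"
    for F y a b Q R Y :: "complex fps"
    using that by algebra
  have "?P * ((f oo sin_sq_param) * ((exp_param + 1) * (exp_param ^ n - 1))) =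
      ?P * (- (exp_param - 1) * (exp_param * q w + fps_const v * q v))"
    by (rule alg[OF e3 qw qv wv])
  note * = this
  have "?P \<noteq> 0" using exp_param_minus_const_nonzero by simp
  from mult_left_cancel[THEN iffD1, OF this *] show ?thesis unfolding v_def .
qed

text \<open>The closed form \<open>n cot (n t) tan t\<close> with denominators cleared, since
  \<open>\<i> cot t = - (y + 1) / (y - 1)\<close>.  Summing the decomposed summands over all roots of unity
  leaves only one power of \<open>y\<close> from each half, because the other power sums of the roots
  vanish; the term of \<open>w = 1\<close> is then subtracted.\<close>

lemma csc_gf_compose:
  assumes n: "n > 0"
  shows "(csc_gf n oo sin_sq_param) * ((exp_param + 1) * (exp_param ^ n - 1)) =
      of_nat n * ((exp_param - 1) * (exp_param ^ n + 1))"
proof -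
  define f where "f = (\<lambda>w. Abs_fps (\<lambda>m. if m = 0 then 0 else half_sin_sq w powi (- int m)))"
  define q where "q = (\<lambda>w. \<Sum>k<n. fps_const (w ^ k) * exp_param ^ (n - Suc k))"
  define h where "h = (\<lambda>w. - (exp_param - 1) * (exp_param * q w + fps_const (inverse w) * q (inverse w)))"
  have gf: "csc_gf n = 1 - (\<Sum>w\<in>unity_roots n - {1}. f w)"
    by (rule fps_ext) (simp add: csc_gf_def f_def csc_power_sum_def fps_sum_nth)
  have fin: "finite (unity_roots n)" using n by simp
  have sum_const: "(\<Sum>w\<in>unity_roots n. fps_const (g w) * c) = fps_const (\<Sum>w\<in>unity_roots n. g w) * c"
    for g :: "complex \<Rightarrow> complex" and c
    by (simp add: sum_distrib_right[symmetric] fps_const_sum_eq)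
  have q1: "(\<Sum>w\<in>unity_roots n. q w) = of_nat n * exp_param ^ (n - 1)"
  proof -
    have "(\<Sum>w\<in>unity_roots n. q w) = (\<Sum>k<n. fps_const (\<Sum>w\<in>unity_roots n. w ^ k) * exp_param ^ (n - Suc k))"
      unfolding q_def by (subst sum.swap) (simp add: sum_const)
    also have "\<dots> = (\<Sum>k\<in>{0}. fps_const (\<Sum>w\<in>unity_roots n. w ^ k) * exp_param ^ (n - Suc k))"
      by (rule sum.mono_neutral_right) (use n sum_unity_roots_power in auto)
    finally show ?thesis using n by (simp add: fps_of_nat)
  qed
  have q2: "(\<Sum>w\<in>unity_roots n. fps_const (inverse w) * q (inverse w)) = of_nat n"
  proof -
    have "(\<Sum>w\<in>unity_roots n. fps_const (inverse w) * q (inverse w)) = (\<Sum>w\<in>unity_roots n. fps_const w * q w)"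
      by (rule sum_unity_roots_inverse)
    also have "\<dots> = (\<Sum>k<n. fps_const (\<Sum>w\<in>unity_roots n. w ^ Suc k) * exp_param ^ (n - Suc k))"
      unfolding q_def sum_distrib_left
        by (subst sum.swap) (simp add: sum_const[symmetric] mult.assoc[symmetric]
          fps_const_mult[symmetric] del: fps_const_mult)
    also have "\<dots> = (\<Sum>k\<in>{n - 1}. fps_const (\<Sum>w\<in>unity_roots n. w ^ Suc k) * exp_param ^ (n - Suc k))"
    proof (rule sum.mono_neutral_right)
      show "\<forall>k\<in>{..<n} - {n - 1}. fps_const (\<Sum>w\<in>unity_roots n. w ^ Suc k) * exp_param ^ (n - Suc k) = 0"
      proof
        fix k assume "k \<in> {..<n} - {n - 1}"
        hence "(\<Sum>w\<in>unity_roots n. w ^ Suc k) = 0"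
          by (intro sum_unity_roots_power) auto
        thus "fps_const (\<Sum>w\<in>unity_roots n. w ^ Suc k) * exp_param ^ (n - Suc k) = 0"
            by (simp only: fps_const_0_eq_0 mult_zero_left)
      qed
    qed (use n in auto)
    also have "\<dots> = fps_const (\<Sum>w\<in>unity_roots n. w ^ n)" using n by (simp del: power_Suc)
    also have "(\<Sum>w\<in>unity_roots n. w ^ n) = (\<Sum>w\<in>unity_roots n. 1)"
      by (rule sum.cong) (auto simp: unity_roots_def)
    finally show ?thesis using n by (simp add: fps_of_nat)
  qed
  have q_1: "(exp_param - 1) * q 1 = exp_param ^ n - 1"
    using power_diff_sumr2[of exp_param n 1]
      sum.nat_diff_reindex[of "\<lambda>k. exp_param ^ k" n] by (simp add: q_def)
  have "(\<Sum>w\<in>unity_roots n. h w) =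
      - (exp_param - 1) * (exp_param * (of_nat n * exp_param ^ (n - 1)) + of_nat n)"
    unfolding h_def by (simp only: sum_distrib_left[symmetric] sum.distrib q1 q2)
  also have "\<dots> = - (exp_param - 1) * (of_nat n * (exp_param ^ n + 1))"
    using n by (cases n) (simp_all add: algebra_simps)
  finally have hall: "(\<Sum>w\<in>unity_roots n. h w) = - (exp_param - 1) * (of_nat n * (exp_param ^ n + 1))" .
  have h1: "h 1 = - (exp_param + 1) * (exp_param ^ n - 1)"
  proof -
    have "h 1 = - (exp_param - 1) * (exp_param * q 1 + q 1)" by (simp add: h_def)
    also have "\<dots> = - (exp_param + 1) * ((exp_param - 1) * q 1)" by (simp add: algebra_simps)
    finally show ?thesis unfolding q_1 .
  qed
  have "((\<Sum>w\<in>unity_roots n - {1}. f w) oo sin_sq_param) * ((exp_param + 1) * (exp_param ^ n - 1)) =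
        (\<Sum>w\<in>unity_roots n - {1}. h w)"
    unfolding fps_compose_sum_distrib sum_distrib_right
  proof (rule sum.cong)
    fix w assume w: "w \<in> unity_roots n - {1}"
    show "(f w oo sin_sq_param) * ((exp_param + 1) * (exp_param ^ n - 1)) = h w"
      unfolding f_def h_def q_def
      by (rule csc_summand_compose) (use w n in \<open>auto simp: unity_roots_def power_0_left\<close>)
  qed simp
  also have "\<dots> = - (exp_param - 1) * (of_nat n * (exp_param ^ n + 1))
      + (exp_param + 1) * (exp_param ^ n - 1)"
    using fin by (simp only: sum_diff1 hall h1 finite_unity_roots one_in_unity_roots if_True
      mult_minus_left diff_minus_eq_add)
  finally have e: "((\<Sum>w\<in>unity_roots n - {1}. f w) oo sin_sq_param)
      * ((exp_param + 1) * (exp_param ^ n - 1)) =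
     - (exp_param - 1) * (of_nat n * (exp_param ^ n + 1)) + (exp_param + 1) * (exp_param ^ n - 1)" .
  have "(csc_gf n oo sin_sq_param) = 1 - ((\<Sum>w\<in>unity_roots n - {1}. f w) oo sin_sq_param)"
    by (simp add: gf fps_compose_sub_distrib)
  then have "(csc_gf n oo sin_sq_param) * ((exp_param + 1) * (exp_param ^ n - 1)) =
      (exp_param + 1) * (exp_param ^ n - 1) -
     ((\<Sum>w\<in>unity_roots n - {1}. f w) oo sin_sq_param) * ((exp_param + 1) * (exp_param ^ n - 1))"
    by (simp add: left_diff_distrib)
  also have "\<dots> = of_nat n * ((exp_param - 1) * (exp_param ^ n + 1))"
    unfolding e by (simp add: mult.left_commute flip: mult_minus_left)
  finally show ?thesis .
qed

lemma sin_sq_param_deriv: "(4 * exp_param * fps_deriv sin_sq_param) * exp_param = 1 - exp_param\<^sup>2"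
proof -
  have "fps_deriv (4 * exp_param * sin_sq_param) = fps_deriv (- (exp_param - 1)\<^sup>2)"
      by (simp only: sin_sq_param_eq)
  hence "4 * exp_param * fps_deriv sin_sq_param + 4 * sin_sq_param = - 2 * (exp_param - 1)"
    by (simp add: power2_eq_square algebra_simps)
  thus ?thesis using sin_sq_param_eq by algebra
qed

text \<open>The function \<open>u = n cot (n t)\<close> satisfies \<open>u' = - n\<^sup>2 - u\<^sup>2\<close>; this is the resulting equation for
  \<open>u tan t\<close> in the variable \<open>x = sin\<^sup>2 t\<close>.  It suffices to check it after the substitution of
  \<open>sin_sq_param\<close>, where all series are rational functions of \<open>y\<close> and \<open>y\<^sup>n\<close>.\<close>

lemma csc_gf_riccati:
  assumes n: "n > 0"
  shows "2 * fps_X * (1 - fps_X) * fps_deriv (csc_gf n) =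
         csc_gf n - of_nat n ^ 2 * fps_X - (1 - fps_X) * csc_gf n ^ 2"
proof -
  let ?F = "csc_gf n" and ?F' = "fps_deriv (csc_gf n)"
  define G where "G = ?F oo sin_sq_param"
  define Y where "Y = exp_param ^ n"
  define N where "N = (of_nat n :: complex fps)"
  define D where "D = ?F' oo sin_sq_param"
  have dG: "fps_deriv G = D * fps_deriv sin_sq_param"
    unfolding G_def D_def by (rule fps_compose_deriv) simp
  have dY: "exp_param * fps_deriv Y = N * Y"
  proof -
    have "fps_deriv Y = N * fps_deriv exp_param * exp_param ^ (n - 1)"
      by (simp add: Y_def N_def fps_deriv_power fps_of_nat)
    thus ?thesis using n by (cases n) (simp_all add: Y_def)
  qed
  have dN: "fps_deriv N = 0" by (simp add: N_def)
  have GE: "G * ((exp_param + 1) * (Y - 1)) = N * ((exp_param - 1) * (Y + 1))"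
    unfolding G_def Y_def N_def by (rule csc_gf_compose[OF n])
  have "fps_deriv (G * ((exp_param + 1) * (Y - 1))) = fps_deriv (N * ((exp_param - 1) * (Y + 1)))"
    by (simp only: GE)
  hence dGE: "fps_deriv G * ((exp_param + 1) * (Y - 1)) + G * ((Y - 1) + (exp_param + 1) * fps_deriv Y) =
     N * ((Y + 1) + (exp_param - 1) * fps_deriv Y)"
    by (simp add: dN algebra_simps)
  have Y1: "Y - 1 \<noteq> 0"
  proof
    assume "Y - 1 = 0"
    hence "N * Y = 0" using dY by simp
    thus False using n \<open>Y - 1 = 0\<close> by (simp add: N_def)
  qed
  have y1: "exp_param + 1 \<noteq> 0"
  proof
    assume "exp_param + 1 = 0"
    hence "fps_nth (exp_param + 1) 0 = 0" by simp
    thus False by simp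
  qed
  have y0: "exp_param \<noteq> 0" using exp_param_minus_const_nonzero[of 0] by simp
  note X = sin_sq_param_eq and dX = sin_sq_param_deriv
  \<comment> \<open>The chain rule: \<open>dx/dt = 2 sin t cos t\<close>, so \<open>x (1 - x)\<close> is a multiple of \<open>(dx/dt)\<^sup>2\<close>.\<close>
  have "4 * exp_param\<^sup>2 * (4 * sin_sq_param * (1 - sin_sq_param) * D) =
      4 * exp_param\<^sup>2 * ((exp_param\<^sup>2 - 1) * fps_deriv G)"
  proof -
    have "(4 * exp_param * sin_sq_param) * (4 * exp_param - 4 * exp_param * sin_sq_param) =
        (4 * exp_param * fps_deriv sin_sq_param * exp_param) * (exp_param\<^sup>2 - 1)"
      unfolding X dX by algebra
    thus ?thesis unfolding dG by algebra
  qed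
  note * = this
  have e1: "4 * sin_sq_param * (1 - sin_sq_param) * D = (exp_param\<^sup>2 - 1) * fps_deriv G"
  proof -
    have "4 * exp_param\<^sup>2 \<noteq> 0" using y0 by simp
    from mult_left_cancel[THEN iffD1, OF this *] show ?thesis .
  qed
  let ?P = "(exp_param + 1) * (Y - 1)"
  have e2: "exp_param * (?P\<^sup>2 * fps_deriv G) =
      2 * N * (exp_param * (Y\<^sup>2 - 1) - (exp_param\<^sup>2 - 1) * (N * Y))"
    using dGE GE dY by algebra
  let ?T = "2 * sin_sq_param * (1 - sin_sq_param) * D - (G - N\<^sup>2 * sin_sq_param - (1 - sin_sq_param) * G\<^sup>2)"
  \<comment> \<open>Multiplication by \<open>8 y (y + 1)\<^sup>2 (Y - 1)\<^sup>2\<close> makes the claim polynomial in \<open>y\<close> and \<open>Y\<close>.\<close>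
  have "8 * exp_param * ?P\<^sup>2 * ?T = 4 * exp_param * ?P\<^sup>2 * (4 * sin_sq_param * (1 - sin_sq_param) * D)
      - 8 * exp_param * ?P * (G * ?P)
      + 2 * N\<^sup>2 * ?P\<^sup>2 * (4 * exp_param * sin_sq_param) + 2 * (4 * exp_param - 4 * exp_param *
          sin_sq_param) * (G * ?P)\<^sup>2"
    by algebra
  also have "\<dots> = 4 * (exp_param\<^sup>2 - 1) * (exp_param * (?P\<^sup>2 * fps_deriv G)) - 8 * exp_param * ?P * (G * ?P)
      + 2 * N\<^sup>2 * ?P\<^sup>2 * (4 * exp_param * sin_sq_param) + 2 * (4 * exp_param - 4 * exp_param *
          sin_sq_param) * (G * ?P)\<^sup>2"
    unfolding e1 by algebra
  also have "\<dots> = 0"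
    unfolding e2 GE X by algebra
  finally have T0: "?T = 0" using y0 y1 Y1 by simp
  let ?S = "2 * fps_X * (1 - fps_X) * ?F' - (?F - N\<^sup>2 * fps_X - (1 - fps_X) * ?F\<^sup>2)"
  have "?S oo sin_sq_param = ?T"
    by (simp add: N_def G_def D_def power2_eq_square fps_compose_mult_distrib fps_compose_sub_distrib
      fps_of_nat[symmetric])
  with T0 have "?S = 0"
    using fps_compose_eq_0_iff[of sin_sq_param ?S] sin_sq_param_nonzero by simp
  thus ?thesis unfolding N_def by simp
qed

section \<open>Polynomiality of the power sums\<close>

lemma csc_gf_nth_0 [simp]: "fps_nth (csc_gf n) 0 = 1"
  by (simp add: csc_gf_def)

lemma csc_gf_nth: "m > 0 \<Longrightarrow> fps_nth (csc_gf n) m = - csc_power_sum (int m) n"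
  by (simp add: csc_gf_def)

lemma sum_atMost_Suc_ends:
  "(\<Sum>i\<le>Suc m. f i) = f 0 + (\<Sum>i=1..m. f i) + (f (Suc m) :: 'a :: comm_monoid_add)"
proof -
  have "{..Suc m} = insert 0 (insert (Suc m) {1..m})" by auto
  thus ?thesis by (simp add: ac_simps)
qed

lemma csc_gf_recursion:
  assumes n: "n > 0"
  defines "F \<equiv> csc_gf n"
  shows "of_nat (2 * m + 3) * F $ Suc m = of_nat (2 * m) * F $ m
     - (if m = 0 then of_nat n ^ 2 else 0) - (\<Sum>i=1..m. F $ i * F $ (Suc m - i))
     + (\<Sum>i\<le>m. F $ i * F $ (m - i))"
proof -
  have F0: "F $ 0 = 1" by (simp add: F_def)
  have F2: "(F ^ 2) $ k = (\<Sum>i\<le>k. F $ i * F $ (k - i))" for k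
    by (simp add: power2_eq_square fps_mult_nth atLeast0AtMost)
  have l: "(2 * fps_X * (1 - fps_X) * fps_deriv F) $ Suc m =
      2 * (of_nat (Suc m) * F $ Suc m - of_nat m * F $ m)"
  proof -
    have "2 * fps_X * (1 - fps_X) * fps_deriv F =
        fps_const 2 * (fps_X * (fps_deriv F - fps_X * fps_deriv F))"
      by (simp add: algebra_simps numeral_fps_const)
    then show ?thesis by (simp only: fps_mult_left_const_nth) (cases m; simp add: algebra_simps)
  qed
  have r: "(F - of_nat n ^ 2 * fps_X - (1 - fps_X) * F ^ 2) $ Suc m =
    F $ Suc m - (if m = 0 then of_nat n ^ 2 else 0) - (F^2) $ Suc m + (F^2) $ m"
  proof -
    have "F - of_nat n ^ 2 * fps_X - (1 - fps_X) * F ^ 2 =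
      F - fps_const (of_nat n ^ 2) * fps_X - F^2 + fps_X * F^2"
      by (simp add: algebra_simps fps_of_nat[symmetric] fps_const_power)
    then show ?thesis by (simp only:) simp
  qed
  have "(F^2) $ Suc m = 2 * F $ Suc m + (\<Sum>i=1..m. F $ i * F $ (Suc m - i))"
    unfolding F2 sum_atMost_Suc_ends by (simp add: F0)
  moreover have "2 * (of_nat (Suc m) * F $ Suc m - of_nat m * F $ m) =
    F $ Suc m - (if m = 0 then of_nat n ^ 2 else 0) - (F^2) $ Suc m + (F^2) $ m"
    using csc_gf_riccati[OF n] l r unfolding F_def by simp
  ultimately show ?thesis unfolding F2[of m] by (simp add: algebra_simps)
qed

text \<open>The recursion of \<open>csc_gf_recursion\<close>, with the number \<open>n\<close> of roots replaced by an indeterminate.\<close>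

fun csc_gf_poly :: "nat \<Rightarrow> rat poly" where
  "csc_gf_poly 0 = 1"
| "csc_gf_poly (Suc m) = smult (1 / of_nat (2 * m + 3))
     (smult (of_nat (2 * m)) (csc_gf_poly m)
      - (if m = 0 then monom 1 2 else 0)
      - (\<Sum>i=1..m. csc_gf_poly i * csc_gf_poly (Suc m - i))
      + (\<Sum>i\<le>m. csc_gf_poly i * csc_gf_poly (m - i)))"

declare csc_gf_poly.simps(2) [simp del]

lemma csc_gf_nth_poly:
  assumes n: "n > 0"
  shows "fps_nth (csc_gf n) m = of_rat (poly (csc_gf_poly m) (of_nat n))"
proof (induction m rule: less_induct)
  case (less m)
  show ?case
  proof (cases m)
    case (Suc k)
    have IH: "fps_nth (csc_gf n) i = of_rat (poly (csc_gf_poly i) (of_nat n))" if "i \<le> k" for i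
      using less Suc that by simp
    have nz: "(of_nat (2 * k + 3) :: complex) \<noteq> 0" by (simp only: of_nat_eq_0_iff)
    have nz': "(of_nat (2 * k + 3) :: rat) \<noteq> 0" by (simp only: of_nat_eq_0_iff)
    have p: "of_nat (2 * k + 3) * poly (csc_gf_poly (Suc k)) (of_nat n) =
      of_nat (2 * k) * poly (csc_gf_poly k) (of_nat n) - (if k = 0 then of_nat n ^ 2 else 0)
      - (\<Sum>i=1..k. poly (csc_gf_poly i) (of_nat n) * poly (csc_gf_poly (Suc k - i)) (of_nat n))
     + (\<Sum>i\<le>k. poly (csc_gf_poly i) (of_nat n) * poly (csc_gf_poly (k - i)) (of_nat n))"
      using nz' by (simp add: csc_gf_poly.simps(2) poly_sum poly_monom del: of_nat_add of_nat_mult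
        sum.cl_ivl_Suc)
    have s: "(\<Sum>i=1..k. csc_gf n $ i * csc_gf n $ (Suc k - i)) =
      (\<Sum>i=1..k. of_rat (poly (csc_gf_poly i) (of_nat n)) * of_rat (poly (csc_gf_poly (Suc k - i)) (of_nat
          n)))"
      by (rule sum.cong) (auto simp: IH)
    have "of_nat (2 * k + 3) * (of_rat (poly (csc_gf_poly (Suc k)) (of_nat n)) :: complex) =
       of_rat (of_nat (2 * k + 3) * poly (csc_gf_poly (Suc k)) (of_nat n))"
      by (simp add: of_rat_mult del: of_nat_add of_nat_mult)
    also have "\<dots> = of_nat (2 * k + 3) * fps_nth (csc_gf n) (Suc k)"
      unfolding p csc_gf_recursion[OF n] s
      by (simp add: IH of_rat_mult of_rat_add of_rat_diff of_rat_sum of_rat_power del: of_nat_mult)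
    finally show ?thesis using nz Suc by (simp del: of_nat_add of_nat_mult)
  qed simp
qed

lemma degree_csc_gf_poly: "degree (csc_gf_poly m) \<le> 2 * m"
proof (induction m rule: less_induct)
  case (less m)
  show ?case
  proof (cases m)
    case (Suc k)
    have IH: "degree (csc_gf_poly i) \<le> 2 * i" if "i \<le> k" for i
      using less Suc that by simp
    have "degree (csc_gf_poly i * csc_gf_poly j) \<le> 2 * Suc k" if "i \<le> k" "j \<le> k" "i + j \<le> Suc k" for i j
      using degree_mult_le[of "csc_gf_poly i" "csc_gf_poly j"] IH[OF that(1)] IH[OF that(2)] that(3) by simp
    moreover have "degree (csc_gf_poly k) \<le> 2 * Suc k" using IH[of k] by simp
    moreover have "degree (if k = 0 then monom (1::rat) 2 else 0) \<le> 2 * Suc k"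
        by (simp add: degree_monom_eq)
    ultimately show ?thesis unfolding Suc csc_gf_poly.simps
      by (intro order.trans[OF degree_smult_le] degree_add_le degree_diff_le degree_sum_le) auto
  qed simp
qed

lemma coeff_mult_degree_le:
  assumes "degree A \<le> a" "degree B \<le> b"
  shows "coeff (A * B) (a + b) = coeff A a * (coeff B b :: 'a :: comm_semiring_0)"
proof -
  have "coeff (A * B) (a + b) = (\<Sum>i\<le>a + b. coeff A i * coeff B (a + b - i))"
    by (rule coeff_mult)
  also have "\<dots> = (\<Sum>i\<in>{a}. coeff A i * coeff B (a + b - i))"
  proof (rule sum.mono_neutral_right)
    show "\<forall>i\<in>{..a + b} - {a}. coeff A i * coeff B (a + b - i) = 0"
    proof
      fix i assume i: "i \<in> {..a + b} - {a}"
      consider "i > a" | "a + b - i > b" using i by force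
      thus "coeff A i * coeff B (a + b - i) = 0"
        using assms by cases (simp_all add: coeff_eq_0)
    qed
  qed auto
  finally show ?thesis by simp
qed

section \<open>The leading coefficient and the Bernoulli numbers\<close>

text \<open>The Taylor coefficients of \<open>t / (e\<^sup>t - 1)\<close> of even order.\<close>

definition even_bernoulli :: "nat \<Rightarrow> rat" where
  "even_bernoulli m = bernoulli_number (2 * m) / fact (2 * m)"

text \<open>The even function \<open>t / (e\<^sup>t - 1) + t / 2 = (t / 2) coth (t / 2)\<close>.\<close>

definition bernoulli_gf :: "rat fps" where
  "bernoulli_gf = Abs_fps (\<lambda>n. bernoulli_number n / fact n) + fps_const (1/2) * fps_X"

text \<open>Differentiating \<open>b (e\<^sup>t - 1) = t\<close> gives \<open>t b' = b - b t - b\<^sup>2\<close>; adding \<open>t / 2\<close> to \<open>b\<close>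
  completes the square.\<close>

lemma bernoulli_gf_riccati:
  "fps_X * fps_deriv bernoulli_gf = bernoulli_gf - bernoulli_gf ^ 2 + fps_const (1/4) * fps_X ^ 2"
proof -
  define b where "b = Abs_fps (\<lambda>n. bernoulli_number n / fact n :: rat)"
  define e where "e = fps_exp (1::rat) - 1"
  have be: "b * e = fps_X" unfolding b_def e_def by (rule bernoulli_number_gf)
  have de: "fps_deriv e = e + 1" by (simp add: e_def)
  have "fps_deriv (b * e) = 1" by (simp add: be)
  hence d: "fps_deriv b * e + b * (e + 1) = 1" using de by (simp add: algebra_simps)
  have e0: "e \<noteq> 0" using be by auto
  have "e * (fps_X * fps_deriv b) = e * (b - b * fps_X - b ^ 2)"
  proof -
    have "e * (fps_X * fps_deriv b) = fps_X * (fps_deriv b * e)" by (simp only: mult_ac)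
    also have "fps_deriv b * e = 1 - b * (e + 1)"
      using d by (simp only: eq_diff_eq)
    also have "fps_X * (1 - b * (e + 1)) = e * (b - b * fps_X - b ^ 2)"
      unfolding be[symmetric] by (simp add: algebra_simps power2_eq_square)
    finally show ?thesis .
  qed
  hence r: "fps_X * fps_deriv b = b - b * fps_X - b ^ 2"
    using mult_left_cancel[THEN iffD1, OF e0] by blast
  define h where "h = fps_const (1/2 :: rat)"
  have h: "2 * h = 1" by (simp add: h_def numeral_fps_const)
  have q: "fps_const (1/4) = h ^ 2" by (simp add: h_def fps_const_power power2_eq_square)
  have g: "bernoulli_gf = b + h * fps_X" by (simp add: bernoulli_gf_def b_def h_def)
  have dg: "fps_deriv bernoulli_gf = fps_deriv b + h" by (simp add: g h_def)
  show ?thesis unfolding dg q unfolding g using r h by algebra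
qed

lemma bernoulli_number_0: "bernoulli_number 0 = 1"
proof -
  have "(Abs_fps (\<lambda>n. bernoulli_number n / fact n) * (fps_exp 1 - 1)) $ 1 = fps_X $ 1"
    by (simp only: bernoulli_number_gf)
  thus ?thesis by (simp add: fps_mult_nth)
qed

lemma bernoulli_gf_recursion:
  "of_nat (m + 2) * bernoulli_gf $ Suc m = (if m = 1 then 1/4 else 0)
     - (\<Sum>i=1..m. bernoulli_gf $ i * bernoulli_gf $ (Suc m - i))"
proof -
  have F0: "bernoulli_gf $ 0 = 1" by (simp add: bernoulli_gf_def bernoulli_number_0)
  have "(bernoulli_gf ^ 2) $ Suc m =
      2 * bernoulli_gf $ Suc m + (\<Sum>i=1..m. bernoulli_gf $ i * bernoulli_gf $ (Suc m - i))"
    unfolding power2_eq_square fps_mult_nth atLeast0AtMost sum_atMost_Suc_ends by (simp add: F0)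
  moreover have "(fps_X * fps_deriv bernoulli_gf) $ Suc m =
      (bernoulli_gf - bernoulli_gf ^ 2 + fps_const (1/4) * fps_X ^ 2) $ Suc m"
    by (simp only: bernoulli_gf_riccati)
  ultimately show ?thesis by (simp add: algebra_simps fps_X_power_nth split: if_splits)
qed

lemma bernoulli_gf_odd: "odd m \<Longrightarrow> bernoulli_gf $ m = 0"
proof (induction m rule: less_induct)
  case (less m)
  then obtain k where k: "m = Suc k" "even k" by (cases m) auto
  have "(\<Sum>i=1..k. bernoulli_gf $ i * bernoulli_gf $ (Suc k - i)) = 0"
  proof (rule sum.neutral, rule ballI)
    fix i assume i: "i \<in> {1..k}"
    have "odd i \<or> odd (Suc k - i)" using i k by auto
    thus "bernoulli_gf $ i * bernoulli_gf $ (Suc k - i) = 0"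
      using less.IH[of i] less.IH[of "Suc k - i"] i k by auto
  qed
  moreover have "k \<noteq> 1" using k by auto
  ultimately have "of_nat (k + 2) * bernoulli_gf $ Suc k = 0"
    using bernoulli_gf_recursion[of k] by simp
  thus ?case using k by (simp only: mult_eq_0_iff of_nat_eq_0_iff) simp
qed

lemma bernoulli_gf_even: "bernoulli_gf $ (2 * m) = even_bernoulli m"
  by (simp add: bernoulli_gf_def even_bernoulli_def fps_X_def)

lemma even_bernoulli_recursion:
  "of_nat (2 * m + 3) * even_bernoulli (Suc m) = (if m = 0 then 1/4 else 0)
     - (\<Sum>i=1..m. even_bernoulli i * even_bernoulli (Suc m - i))"
proof -
  \<comment> \<open>Terms with odd index vanish.\<close>
  have "(\<Sum>i=1..2*m+1. bernoulli_gf $ i * bernoulli_gf $ (Suc (2*m+1) - i)) =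
        (\<Sum>i\<in>(\<lambda>i. 2 * i) ` {1..m}. bernoulli_gf $ i * bernoulli_gf $ (Suc (2*m+1) - i))"
  proof (rule sum.mono_neutral_right)
    show "\<forall>i\<in>{1..2*m+1} - (\<lambda>i. 2 * i) ` {1..m}. bernoulli_gf $ i * bernoulli_gf $ (Suc (2*m+1) - i) = 0"
    proof
      fix i assume i: "i \<in> {1..2*m+1} - (\<lambda>i. 2 * i) ` {1..m}"
      have "odd i"
      proof
        assume "even i"
        then obtain j where "i = 2 * j" by auto
        moreover from this i have "j \<in> {1..m}" by auto
        ultimately show False using i by blast
      qed
      thus "bernoulli_gf $ i * bernoulli_gf $ (Suc (2*m+1) - i) = 0" by (simp add: bernoulli_gf_odd)
    qed
  qed auto
  also have "\<dots> = (\<Sum>i=1..m. bernoulli_gf $ (2 * i) * bernoulli_gf $ (2 * (Suc m - i)))"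
    by (subst sum.reindex) (auto simp: inj_on_def intro!: sum.cong, (simp add: algebra_simps)?)
  finally have "(\<Sum>i=1..2*m+1. bernoulli_gf $ i * bernoulli_gf $ (Suc (2*m+1) - i)) =
     (\<Sum>i=1..m. even_bernoulli i * even_bernoulli (Suc m - i))" by (simp only: bernoulli_gf_even)
  with bernoulli_gf_recursion[of "2 * m + 1"] bernoulli_gf_even[of "Suc m"] show ?thesis
    by (simp add: algebra_simps)
qed

text \<open>In the recursion for \<open>csc_gf_poly\<close> only the quadratic convolution with indices summing to
  \<open>m + 1\<close>, and initially the term \<open>n\<^sup>2\<close>, can reach the degree \<open>2 (m + 1)\<close>.  What remains is the
  recursion of the Bernoulli numbers, rescaled by \<open>- 4\<close>.\<close>

lemma coeff_csc_gf_poly: "coeff (csc_gf_poly m) (2 * m) = (- 4) ^ m * even_bernoulli m"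
proof (induction m rule: less_induct)
  case (less m)
  show ?case
  proof (cases m)
    case 0
    then show ?thesis by (simp add: even_bernoulli_def bernoulli_number_0)
  next
    case (Suc k)
    have IH: "coeff (csc_gf_poly i) (2 * i) = (- 4) ^ i * even_bernoulli i" if "i \<le> k" for i
      using less Suc that by simp
    have 1: "coeff (csc_gf_poly k) (2 * Suc k) = 0"
      using degree_csc_gf_poly[of k] by (intro coeff_eq_0) simp
    have 2: "coeff (csc_gf_poly i * csc_gf_poly (k - i)) (2 * Suc k) = 0" if "i \<le> k" for i
      using degree_mult_le[of "csc_gf_poly i" "csc_gf_poly (k - i)"]
        degree_csc_gf_poly[of i] degree_csc_gf_poly[of "k - i"] that by (intro coeff_eq_0) auto
    have 3: "coeff (csc_gf_poly i * csc_gf_poly (Suc k - i)) (2 * Suc k) =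
       (- 4) ^ Suc k * (even_bernoulli i * even_bernoulli (Suc k - i))" if "i \<in> {1..k}" for i
    proof -
      have "2 * Suc k = 2 * i + 2 * (Suc k - i)" using that by auto
      hence "coeff (csc_gf_poly i * csc_gf_poly (Suc k - i)) (2 * Suc k) =
         coeff (csc_gf_poly i) (2 * i) * coeff (csc_gf_poly (Suc k - i)) (2 * (Suc k - i))"
        using coeff_mult_degree_le[OF degree_csc_gf_poly degree_csc_gf_poly] by metis
      also have "\<dots> = ((- 4) ^ i * (- 4) ^ (Suc k - i)) * (even_bernoulli i * even_bernoulli (Suc k - i))"
      proof -
        have "i \<le> k" "Suc k - i \<le> k" using that by auto
        thus ?thesis by (simp only: IH) (simp only: mult_ac)
      qed
      also have "(- 4 :: rat) ^ i * (- 4) ^ (Suc k - i) = (- 4) ^ Suc k"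
        using that by (simp add: power_add[symmetric])
      finally show ?thesis .
    qed
    have "coeff (csc_gf_poly (Suc k)) (2 * Suc k) = 1 / of_nat (2 * k + 3) *
       (- (if k = 0 then 1 else 0) - (\<Sum>i=1..k. (- 4) ^ Suc k * (even_bernoulli i * even_bernoulli (Suc k
           - i))))"
      unfolding csc_gf_poly.simps coeff_smult coeff_add coeff_diff coeff_sum 1
      using 2 3 by simp
    also have "\<dots> = 1 / of_nat (2 * k + 3) * ((- 4) ^ Suc k * ((if k = 0 then 1 / 4 else 0) -
       (\<Sum>i=1..k. even_bernoulli i * even_bernoulli (Suc k - i))))"
      by (simp add: sum_distrib_left right_diff_distrib)
    also have "\<dots> = (- 4) ^ Suc k * even_bernoulli (Suc k)"
      unfolding even_bernoulli_recursion[symmetric] by (simp del: of_nat_add of_nat_mult)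
    finally show ?thesis unfolding Suc .
  qed
qed

lemma bernoulli_tilde_even_bernoulli: "2 * 4 ^ m * bernoulli_tilde m = - ((- 4) ^ m * even_bernoulli m)"
proof -
  have "(- 4 :: rat) ^ m = (- 1) ^ m * 4 ^ m" by (simp add: power_mult_distrib[symmetric])
  thus ?thesis by (simp add: bernoulli_tilde_def even_bernoulli_def)
qed

text \<open>The signs in the definition of \<open>bernoulli_tilde\<close> make all terms of the recursion positive,
  whence \<open>bernoulli_tilde_pos\<close>.\<close>

lemma bernoulli_tilde_recursion:
  "of_nat (2 * m + 3) * bernoulli_tilde (Suc m) = (if m = 0 then 1/8 else 0)
    + 2 * (\<Sum>i=1..m. bernoulli_tilde i * bernoulli_tilde (Suc m - i))"
proof -
  have b: "even_bernoulli m = - 2 * (- 1) ^ m * bernoulli_tilde m" for m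
    by (simp add: bernoulli_tilde_def even_bernoulli_def power_mult_distrib[symmetric])
  have "(\<Sum>i=1..m. even_bernoulli i * even_bernoulli (Suc m - i)) =
      (\<Sum>i=1..m. 4 * (- 1) ^ Suc m * (bernoulli_tilde i * bernoulli_tilde (Suc m - i)))"
  proof (rule sum.cong)
    fix i assume "i \<in> {1..m}"
    hence "(- 1 :: rat) ^ Suc m = (- 1) ^ i * (- 1) ^ (Suc m - i)" by (simp add: power_add[symmetric])
    thus "even_bernoulli i * even_bernoulli (Suc m - i) =
        4 * (- 1) ^ Suc m * (bernoulli_tilde i * bernoulli_tilde (Suc m - i))"
      by (simp add: b)
  qed simp
  hence e: "of_nat (2 * m + 3) * (- 2 * (- 1) ^ Suc m * bernoulli_tilde (Suc m)) =
      (if m = 0 then 1/4 else 0)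
    - 4 * (- 1) ^ Suc m * (\<Sum>i=1..m. bernoulli_tilde i * bernoulli_tilde (Suc m - i))"
    using even_bernoulli_recursion[of m] unfolding b[of "Suc m"] by (simp add: sum_distrib_left)
  show ?thesis
  proof (cases "even m")
    case True
    with e show ?thesis by (cases "m = 0") (auto simp: algebra_simps)
  next
    case False
    with e show ?thesis by (cases "m = 0") (auto simp: algebra_simps)
  qed
qed

lemma bernoulli_tilde_pos: "m > 0 \<Longrightarrow> bernoulli_tilde m > 0"
proof (induction m rule: less_induct)
  case (less m)
  then obtain k where k: "m = Suc k" by (cases m) auto
  have p: "bernoulli_tilde i * bernoulli_tilde (Suc k - i) > 0" if "i \<in> {1..k}" for i
    using less.IH[of i] less.IH[of "Suc k - i"] that k by simp
  have "(\<Sum>i=1..k. bernoulli_tilde i * bernoulli_tilde (Suc k - i)) > 0" if "k > 0"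
    using that p by (intro sum_pos) auto
  hence "(if k = 0 then 1/8 else 0) + 2 * (\<Sum>i=1..k. bernoulli_tilde i * bernoulli_tilde (Suc k - i)) > 0"
    by auto
  hence "of_nat (2 * k + 3) * bernoulli_tilde (Suc k) > 0"
    unfolding bernoulli_tilde_recursion .
  thus ?case unfolding k by (simp add: zero_less_mult_iff)
qed

section \<open>Power sums with arbitrary exponents\<close>

text \<open>Here the sum is one of a Laurent polynomial in \<open>w\<close> with exponents between \<open>- k\<close> and \<open>k\<close>.  As
  \<open>k < n\<close>, only its constant term survives the summation over the roots.  For \<open>k = 0\<close> the
  omitted root \<open>1\<close> contributes the constant \<open>-1\<close>.\<close>

lemma csc_power_sum_nonpos:
  "\<exists>c::rat. \<forall>n>k. csc_power_sum (- int k) n = of_rat (poly [:if k = 0 then -1 else 0, c:] (of_nat n))"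
proof (cases "k = 0")
  case True
  have "csc_power_sum (- int k) n = of_rat (poly [:-1, 1:] (of_nat n))" if "n > k" for n
    using that True
      by (simp add: csc_power_sum_def card_Diff_singleton of_rat_diff of_rat_minus of_nat_diff)
  thus ?thesis using True by (intro exI[of _ 1]) auto
next
  case False
  define c where "c = (-1) ^ k * rat_of_nat ((2 * k) choose k) * (-1) ^ k / 4 ^ k"
  have "csc_power_sum (- int k) n = of_rat (poly [:0, c:] (of_nat n))" if n: "n > k" for n
  proof -
    have fin: "finite (unity_roots n)" using n by simp
    have "csc_power_sum (- int k) n = (\<Sum>w\<in>unity_roots n - {1}. half_sin_sq w ^ k)"
      by (simp add: csc_power_sum_def)
    also have "\<dots> = (\<Sum>w\<in>unity_roots n. half_sin_sq w ^ k)"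
      by (rule sum.mono_neutral_left) (use fin False in auto)
    also have "\<dots> =
        (\<Sum>w\<in>unity_roots n. \<Sum>j\<le>2 * k. of_nat (2 * k choose j) * (-1) ^ j * (-1) ^ k / 4 ^ k * w powi (int
            k - int j))"
    proof (rule sum.cong)
      fix w assume "w \<in> unity_roots n"
      hence w: "w \<noteq> 0" using unity_roots_nonzero n by auto
      have "half_sin_sq w = (-1) * (((- inverse w + 1) ^ 2) * w / 4)"
        using w by (simp add: half_sin_sq_def field_simps power2_eq_square)
      hence "half_sin_sq w ^ k = (-1) ^ k * (- inverse w + 1) ^ (2 * k) * w ^ k / 4 ^ k"
        by (simp only: power_mult_distrib power_divide power_mult mult.assoc times_divide_eq_right)
      also have "\<dots> = (-1) ^ k * (\<Sum>j\<le>2 * k. of_nat (2 * k choose j) * (- inverse w) ^ j) * w ^ k / 4 ^ k"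
        unfolding binomial_ring by simp
      also have "\<dots> =
          (\<Sum>j\<le>2 * k. of_nat (2 * k choose j) * (-1) ^ j * (-1) ^ k / 4 ^ k * w powi (int k - int j))"
        unfolding sum_distrib_left sum_distrib_right sum_divide_distrib
      proof (rule sum.cong)
        fix j
        have "w powi (int k - int j) = w ^ k * inverse w ^ j"
          using w by (simp add: power_int_diff field_simps)
        moreover have "(- inverse w) ^ j = (-1) ^ j * inverse w ^ j" by (rule power_minus)
        ultimately show "(- 1) ^ k * (of_nat (2 * k choose j) * (- inverse w) ^ j) * w ^ k / 4 ^ k =
           of_nat (2 * k choose j) * (-1) ^ j * (-1) ^ k / 4 ^ k * w powi (int k - int j)" by simp
      qed simp
      finally show "half_sin_sq w ^ k =
          (\<Sum>j\<le>2 * k. of_nat (2 * k choose j) * (-1) ^ j * (-1) ^ k / 4 ^ k * w powi (int k - int j))" .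
    qed simp
    also have "\<dots> =
        (\<Sum>j\<le>2 * k. of_nat (2 * k choose j) * (-1) ^ j * (-1) ^ k / 4 ^ k * (\<Sum>w\<in>unity_roots n. w powi (int
            k - int j)))"
      by (subst sum.swap) (simp add: sum_distrib_left)
    also have "\<dots> =
        (\<Sum>j\<le>2 * k. if j = k then of_nat (2 * k choose k) * (-1) ^ k * (-1) ^ k / 4 ^ k * of_nat n else 0)"
      by (rule sum.cong) (use n in \<open>auto simp: sum_unity_roots_power_int\<close>)
    also have "\<dots> = of_nat (2 * k choose k) * (-1) ^ k * (-1) ^ k / 4 ^ k * of_nat n" by simp
    also have "\<dots> = of_rat (poly [:0, c:] (of_nat n))"
      by (simp add: c_def of_rat_mult of_rat_divide of_rat_power of_rat_minus)
    finally show ?thesis .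
  qed
  thus ?thesis using False by auto
qed

lemma csc_power_sum_poly:
  "\<exists>F :: rat poly. (\<forall>n. n > 0 \<and> int n > - m \<longrightarrow> csc_power_sum m n = of_rat (poly F (of_nat n))) \<and>
     degree F \<le> max 1 (nat (2 * m)) \<and>
     (m > 0 \<longrightarrow> coeff F (nat (2 * m)) = 2 * 4 ^ nat m * bernoulli_tilde (nat m))"
proof (cases "m > 0")
  case True
  define k where "k = nat m"
  have k: "m = int k" "k > 0" using True by (auto simp: k_def)
  show ?thesis
  proof (intro exI[of _ "- csc_gf_poly k"] conjI allI impI)
    fix n assume "n > 0 \<and> int n > - m"
    thus "csc_power_sum m n = of_rat (poly (- csc_gf_poly k) (of_nat n))"
      using csc_gf_nth_poly[of n k] csc_gf_nth[of k n] k
      by (simp add: of_rat_minus minus_equation_iff[of "csc_power_sum (int k) n"])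
  next
    show "degree (- csc_gf_poly k) \<le> max 1 (nat (2 * m))" using degree_csc_gf_poly[of k] k
        by (simp add: nat_mult_distrib)
  next
    show "coeff (- csc_gf_poly k) (nat (2 * m)) = 2 * 4 ^ nat m * bernoulli_tilde (nat m)"
      using coeff_csc_gf_poly[of k] bernoulli_tilde_even_bernoulli[of k] k by (simp add: nat_mult_distrib)
  qed
next
  case False
  define k where "k = nat (- m)"
  have k: "m = - int k" using False by (auto simp: k_def)
  obtain c where "\<forall>n>k. csc_power_sum (- int k) n = of_rat (poly [:if k = 0 then -1 else 0, c:] (of_nat n))"
    using csc_power_sum_nonpos by blast
  thus ?thesis using k by (intro exI[of _ "[:if k = 0 then -1 else 0, c:]"]) auto
qed

section \<open>A transfer recursion for colorings\<close>

text \<open>The colorings for an arbitrary integer \<open>d\<close> and end color \<open>c\<close> of the spine; an integer end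
  color permits recursion over the last spine edge.\<close>

definition spine_colorings ::
    "int \<Rightarrow> nat \<Rightarrow> int \<Rightarrow> ((nat \<Rightarrow> int) \<times> (nat \<Rightarrow> int) \<times> (nat \<Rightarrow> int)) set" where
  "spine_colorings d g c =
     {(a, l, k).
        a \<in> extensional {1..g} \<and> l \<in> extensional {1..g} \<and> k \<in> extensional {0..g} \<and>
        k 0 = 0 \<and> k g = c \<and>
        (\<forall>i\<in>{0..g}. 0 \<le> k i \<and> k i \<le> d - 1) \<and>
        (\<forall>i\<in>{1..g}.
           0 \<le> a i \<and> a i \<le> l i \<and> l i \<le> d - 1 \<and>
           \<bar>k (i - 1) - a i\<bar> \<le> k i \<and> k i \<le> k (i - 1) + a i \<and>
           k (i - 1) + a i + k i \<le> 2 * d - 1)}"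

lemma lollipop_colorings_eq:
  "lollipop_colorings p g c = spine_colorings ((int p - 1) div 2) g (int c)"
  by (simp add: lollipop_colorings_def spine_colorings_def Let_def)

text \<open>The characters \<open>\<sigma> = 1\<close> and \<open>\<sigma> = parity_sign\<close> give the sum and, up to the sign \<open>(-1)\<^sup>c\<close>, the
  difference of the numbers of even and odd colorings.\<close>

definition weighted_count :: "(int \<Rightarrow> complex) \<Rightarrow> int \<Rightarrow> nat \<Rightarrow> int \<Rightarrow> complex" where
  "weighted_count \<sigma> d g c = (\<Sum>(a, l, k)\<in>spine_colorings d g c. \<Prod>i=1..g. \<sigma> (a i))"

lemma spine_colorings_0:
  assumes "0 \<le> c" "c < d"
  shows "spine_colorings d 0 c =
      (if c = 0 then {(\<lambda>_. undefined, \<lambda>_. undefined, \<lambda>i. if i = 0 then 0 else undefined)} else {})"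
proof -
  have "k = (\<lambda>i. if i = 0 then 0 else undefined)" if "k \<in> extensional {0}" "k 0 = 0" for k :: "nat \<Rightarrow> int"
    using that by (auto simp: extensional_def fun_eq_iff)
  thus ?thesis using assms by (auto simp: spine_colorings_def) (auto simp: extensional_def)
qed

lemma weighted_count_0:
  assumes "0 \<le> c" "c < d"
  shows "weighted_count \<sigma> d 0 c = (if c = 0 then 1 else 0)"
  using assms by (simp add: weighted_count_def spine_colorings_0)

text \<open>The possible values of the last stick color, the last loop color and the spine color before
  them.  The triangle inequalities are solved for the spine color, which thus runs through an
  interval.\<close>

definition last_steps :: "int \<Rightarrow> int \<Rightarrow> (int \<times> int \<times> int) set" where
  "last_steps d c = (SIGMA A:{0..<d}. {A..<d} \<times> {\<bar>c - A\<bar>..min (c + A) (2 * d - 1 - c - A)})"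

lemma mem_last_steps:
  assumes "0 \<le> c" "c < d"
  shows "(A, L, k) \<in> last_steps d c \<longleftrightarrow> 0 \<le> k \<and> k \<le> d - 1 \<and>
     0 \<le> A \<and> A \<le> L \<and> L \<le> d - 1 \<and> \<bar>k - A\<bar> \<le> c \<and> c \<le> k + A \<and> k + A + c \<le> 2 * d - 1"
  using assms by (auto simp: last_steps_def)

lemma spine_colorings_Suc:
  assumes c: "0 \<le> c" "c < d"
  assumes e: "a \<in> extensional {1..g}" "l \<in> extensional {1..g}" "k \<in> extensional {0..g}"
  shows "(a(Suc g := A), l(Suc g := L), k(Suc g := c)) \<in> spine_colorings d (Suc g) c \<longleftrightarrow>
     (A, L, k g) \<in> last_steps d c \<and> (a, l, k) \<in> spine_colorings d g (k g)"
proof -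
  have s: "{1..Suc g} = insert (Suc g) {1..g}" "{0..Suc g} = insert (Suc g) {0..g}" by auto
  have ext: "a(Suc g := A) \<in> extensional {1..Suc g}" "l(Suc g := L) \<in> extensional {1..Suc g}"
     "k(Suc g := c) \<in> extensional {0..Suc g}"
    using e by (auto simp: extensional_def)
  have k: "(\<forall>i\<in>{0..Suc g}. 0 \<le> (k(Suc g := c)) i \<and> (k(Suc g := c)) i \<le> d - 1) \<longleftrightarrow>
      (\<forall>i\<in>{0..g}. 0 \<le> k i \<and> k i \<le> d - 1)"
    unfolding s using c by auto
  define P where "P = (\<lambda>a l k (i::nat). 0 \<le> a i \<and> a i \<le> l i \<and> l i \<le> d - 1 \<and>
           \<bar>k (i - 1) - a i\<bar> \<le> k i \<and> k i \<le> k (i - 1) + a i \<and>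
           k (i - 1) + a i + (k i::int) \<le> 2 * d - 1)"
  have "P (a(Suc g := A)) (l(Suc g := L)) (k(Suc g := c)) i \<longleftrightarrow> P a l k i" if "i \<in> {1..g}" for i
  proof -
    have "i \<noteq> Suc g" "i - 1 \<noteq> Suc g" using that by auto
    thus ?thesis unfolding P_def by simp
  qed
  hence "(\<forall>i\<in>{1..Suc g}. P (a(Suc g := A)) (l(Suc g := L)) (k(Suc g := c)) i) \<longleftrightarrow>
     P (a(Suc g := A)) (l(Suc g := L)) (k(Suc g := c)) (Suc g) \<and> (\<forall>i\<in>{1..g}. P a l k i)"
    unfolding s by simp
  also have "P (a(Suc g := A)) (l(Suc g := L)) (k(Suc g := c)) (Suc g) \<longleftrightarrow>
     0 \<le> A \<and> A \<le> L \<and> L \<le> d - 1 \<and> \<bar>k g - A\<bar> \<le> c \<and> c \<le> k g + A \<and> k g + A + c \<le> 2 * d - 1"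
    by (simp add: P_def)
  finally have q: "(\<forall>i\<in>{1..Suc g}. P (a(Suc g := A)) (l(Suc g := L)) (k(Suc g := c)) i) \<longleftrightarrow>
     (0 \<le> A \<and> A \<le> L \<and> L \<le> d - 1 \<and> \<bar>k g - A\<bar> \<le> c \<and> c \<le> k g + A \<and> k g + A + c \<le> 2 * d - 1) \<and> (\<forall>i\<in>{1..g}. P
         a l k i)" .
  show ?thesis
    unfolding spine_colorings_def mem_last_steps[OF c] mem_Collect_eq prod.case
    using ext e k q[unfolded P_def] by auto
qed

text \<open>Removing the last lollipop is a bijection onto the pairs of an admissible last step and a
  coloring with one loop less.\<close>

lemma weighted_count_Suc:
  assumes c: "0 \<le> c" "c < d"
  shows "weighted_count \<sigma> d (Suc g) c =
    (\<Sum>A\<in>{0..<d}. \<Sum>L\<in>{A..<d}. \<Sum>k\<in>{\<bar>c - A\<bar>..min (c + A) (2 * d - 1 - c - A)}. \<sigma> A * weighted_count \<sigma> d g k)"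
proof -
  have fin: "finite (last_steps d c)" unfolding last_steps_def by auto
  have fin2: "finite (spine_colorings d g k)" for k
  proof -
    have "spine_colorings d g k \<subseteq> ({1..g} \<rightarrow>\<^sub>E {0..d}) \<times> ({1..g} \<rightarrow>\<^sub>E {0..d}) \<times> ({0..g} \<rightarrow>\<^sub>E {0..d})"
      unfolding spine_colorings_def PiE_def Pi_def by fastforce
    thus ?thesis by (rule finite_subset) (intro finite_cartesian_product finite_PiE; simp)
  qed
  have prod_upd: "(\<Prod>i=1..Suc g. \<sigma> ((a(Suc g := A)) i)) = \<sigma> A * (\<Prod>i=1..g. \<sigma> (a i))" for a A
  proof -
    have "(\<Prod>i=1..g. \<sigma> ((a(Suc g := A)) i)) = (\<Prod>i=1..g. \<sigma> (a i))" by (rule prod.cong) auto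
    thus ?thesis by (simp add: mult.commute)
  qed
  have "(\<Sum>A\<in>{0..<d}. \<Sum>L\<in>{A..<d}. \<Sum>k\<in>{\<bar>c - A\<bar>..min (c + A) (2 * d - 1 - c - A)}. \<sigma> A
      * weighted_count \<sigma> d g k)
    = (\<Sum>A\<in>{0..<d}. \<Sum>(L, k)\<in>{A..<d} \<times> {\<bar>c - A\<bar>..min (c + A) (2 * d - 1 - c - A)}. \<sigma> A * weighted_count \<sigma> d
        g k)"
    by (simp only: sum.cartesian_product)
  also have "\<dots> = (\<Sum>(A, L, k)\<in>last_steps d c. \<sigma> A * weighted_count \<sigma> d g k)"
    unfolding last_steps_def by (subst sum.Sigma) (auto simp: split_def)
  also have "\<dots> =
      (\<Sum>s\<in>last_steps d c. \<Sum>x\<in>spine_colorings d g (snd (snd s)). \<sigma> (fst s) * (\<Prod>i=1..g. \<sigma> (fst x i)))"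
    by (simp add: split_def weighted_count_def sum_distrib_left)
  also have "\<dots> =
      (\<Sum>(s, x)\<in>(SIGMA s:last_steps d c. spine_colorings d g (snd (snd s))). \<sigma> (fst s) * (\<Prod>i=1..g. \<sigma> (fst
          x i)))"
    by (rule sum.Sigma) (use fin fin2 in auto)
  also have "\<dots> = (\<Sum>(a, l, k)\<in>spine_colorings d (Suc g) c. \<Prod>i=1..Suc g. \<sigma> (a i))"
  proof (rule sum.reindex_bij_witness[where
        i = "\<lambda>(a, l, k).
            ((a (Suc g), l (Suc g), k g), (restrict a {1..g}, restrict l {1..g}, restrict k {0..g}))" and
        j = "\<lambda>((A, L, _), (a, l, k)). (a(Suc g := A), l(Suc g := L), k(Suc g := c))"])
    fix z assume z: "z \<in> (SIGMA s:last_steps d c. spine_colorings d g (snd (snd s)))"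
    obtain A L k' a l k where zz: "z = ((A, L, k'), (a, l, k))" by (metis prod.exhaust)
    have m: "(A, L, k') \<in> last_steps d c" "(a, l, k) \<in> spine_colorings d g k'" using z zz by auto
    have e: "a \<in> extensional {1..g}" "l \<in> extensional {1..g}" "k \<in> extensional {0..g}" "k g = k'"
      using m(2) by (auto simp: spine_colorings_def)
    have r: "restrict (a(Suc g := A)) {1..g} = a" "restrict (l(Suc g := L)) {1..g} =
        l" "restrict (k(Suc g := c)) {0..g} = k"
      using e by (auto simp: fun_eq_iff extensional_def)
    show "(case case z of (x, xa) \<Rightarrow> (case x of (A, L, uu) \<Rightarrow> \<lambda>(a, l, k).
        (a(Suc g := A), l(Suc g := L), k(Suc g := c))) xa of
          (a, l, k) \<Rightarrow> ((a (Suc g), l (Suc g), k g), restrict a {1..g}, restrict l {1..g}, restrict k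
              {0..g})) = z"
      unfolding zz using r e by simp
    show "(case z of (x, xa) \<Rightarrow> (case x of (A, L, uu) \<Rightarrow> \<lambda>(a, l, k).
        (a(Suc g := A), l(Suc g := L), k(Suc g := c))) xa) \<in> spine_colorings d (Suc g) c"
      unfolding zz using spine_colorings_Suc[OF c e(1-3)] m e by simp
    show "(case case z of (x, xa) \<Rightarrow> (case x of (A, L, uu) \<Rightarrow> \<lambda>(a, l, k).
        (a(Suc g := A), l(Suc g := L), k(Suc g := c))) xa of
          (a, l, k) \<Rightarrow> \<Prod>i = 1..Suc g. \<sigma> (a i)) = (case z of (s, x) \<Rightarrow> \<sigma> (fst s) * (\<Prod>i = 1..g. \<sigma> (fst x i)))"
      unfolding zz by (simp only: prod.case fst_conv prod_upd)
  next
    fix z assume z: "z \<in> spine_colorings d (Suc g) c"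
    obtain a l k where zz: "z = (a, l, k)" by (metis prod.exhaust)
    have e: "a \<in> extensional {1..Suc g}" "l \<in> extensional {1..Suc g}" "k \<in> extensional {0..Suc g}"
        "k (Suc g) = c"
      using z by (auto simp: zz spine_colorings_def)
    have r: "(restrict a {1..g})(Suc g := a (Suc g)) = a" "(restrict l {1..g})(Suc g := l (Suc g)) = l"
       "(restrict k {0..g})(Suc g := c) = k"
      using e by (auto simp: fun_eq_iff extensional_def)
    show "(case case z of (a, l, k) \<Rightarrow> ((a (Suc g), l (Suc g), k g), restrict a {1..g}, restrict l {1..g},
        restrict k {0..g}) of
          (x, xa) \<Rightarrow> (case x of (A, L, uu) \<Rightarrow> \<lambda>(a, l, k). (a(Suc g := A), l(Suc g := L), k(Suc g := c)))
              xa) = z"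
      unfolding zz using r by simp
    have "(restrict a {1..g}, restrict l {1..g}, restrict k {0..g}) \<in> spine_colorings d g
        (restrict k {0..g} g) \<and>
      (a (Suc g), l (Suc g), restrict k {0..g} g) \<in> last_steps d c"
      using spine_colorings_Suc[OF c, of "restrict a {1..g}" g "restrict l {1..g}" "restrict k {0..g}"
        "a (Suc g)" "l (Suc g)"] z
      unfolding r zz by simp
    thus "(case z of (a, l, k) \<Rightarrow> ((a (Suc g), l (Suc g), k g), restrict a {1..g}, restrict l {1..g},
        restrict k {0..g}))
        \<in> (SIGMA s:last_steps d c. spine_colorings d g (snd (snd s)))"
      unfolding zz by simp
  qed
  finally show ?thesis by (simp add: weighted_count_def)
qed

section \<open>Diagonalization by the fusion rule\<close>

text \<open>For \<open>w = exp (2 \<i> \<theta>)\<close> this is \<open>2 cos (2 (k + 1) \<theta>) - 2 cos (2 k \<theta>) = - 4 sin \<theta> sin ((2 k + 1) \<theta>)\<close>, an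
  eigenvector of the fusion matrices in a form that makes sums over \<open>k\<close> telescope.\<close>

definition cos_increment :: "int \<Rightarrow> complex \<Rightarrow> complex" where
  "cos_increment k w = (w powi (k + 1) + w powi (- (k + 1))) - (w powi k + w powi (- k))"

lemma sum_cos_increment:
  assumes "x \<le> y + 1"
  shows "(\<Sum>k\<in>{x..y}. cos_increment k w) = (w powi (y + 1) + w powi (- (y + 1))) - (w powi x + w powi (- x))"
proof -
  have "x - 1 \<le> y" using assms by simp
  thus ?thesis
  proof (induction y rule: int_ge_induct)
    case base
    then show ?case by simp
  next
    case (step y)
    have "{x..y + 1} = insert (y + 1) {x..y}" using step by auto
    thus ?case using step by (simp add: cos_increment_def)
  qed
qed

text \<open>The sum telescopes.  When the upper limit is the truncated one, it is the reflection of
  \<open>c + A + 1\<close> at \<open>(2 d + 1) / 2\<close>, and the cosine takes the same value there, because \<open>w\<close> is a root of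
  unity of order dividing \<open>2 d + 1\<close>.  The difference of two cosines is then the product
  \<open>sin ((2 A + 1) \<theta>) sin ((2 c + 1) \<theta>)\<close> up to a factor.\<close>

lemma fusion:
  assumes w: "w ^ (2 * d + 1) = 1" and A: "0 \<le> A" "A < int d" and c: "0 \<le> c" "c < int d"
  shows "(\<Sum>k\<in>{\<bar>c - A\<bar>..min (c + A) (2 * int d - 1 - c - A)}. cos_increment k w) =
     (w powi (A + 1) - w powi (- A)) / (w - 1) * cos_increment c w"
proof (cases "w = 1")
  case True
  thus ?thesis by (simp add: cos_increment_def)
next
  case False
  have w0: "w \<noteq> 0" using w by (auto simp: power_0_left)
  define h where "h = (\<lambda>k. w powi k + w powi (- k))"
  have hm: "h (- k) = h k" for k by (simp add: h_def)
  have wp: "w powi (2 * int d + 1) = 1"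
  proof -
    have "w powi (int (2 * d + 1)) = 1" using w by (simp only: power_int_of_nat)
    thus ?thesis by (simp add: algebra_simps)
  qed
  have hp: "h (2 * int d + 1 - k) = h k" for k
    using w0 wp by (simp add: h_def power_int_diff power_int_minus field_simps)
  let ?M = "min (c + A) (2 * int d - 1 - c - A)"
  have "(\<Sum>k\<in>{\<bar>c - A\<bar>..?M}. cos_increment k w) = h (?M + 1) - h \<bar>c - A\<bar>"
    unfolding h_def by (rule sum_cos_increment) (use A c in auto)
  also have "h (?M + 1) = h (c + A + 1)"
  proof (cases "c + A \<le> 2 * int d - 1 - c - A")
    case False
    hence "?M + 1 = 2 * int d + 1 - (c + A + 1)" by simp
    thus ?thesis by (simp only: hp)
  qed simp
  also have "h \<bar>c - A\<bar> = h (c - A)" using hm[of "c - A"] by (simp add: abs_if)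
  also have "h (c + A + 1) - h (c - A) = (w powi (A + 1) - w powi (- A)) / (w - 1) * cos_increment c w"
  proof -
    have "(h (c + A + 1) - h (c - A)) * (w - 1) = (w powi (A + 1) - w powi (- A)) * cos_increment c w"
      using w0 by (simp add: h_def cos_increment_def power_int_add power_int_diff power_int_minus
        field_simps)
    thus ?thesis using False by (simp add: field_simps)
  qed
  finally show ?thesis .
qed

text \<open>The quotient in the sum is \<open>sin ((2 A + 1) \<theta>) / sin \<theta>\<close>, the eigenvalue of the fusion matrix of \<open>A\<close>.
  For \<open>w = 1\<close> it is \<open>0\<close> by convention; there the eigenvector vanishes.\<close>

definition loop_eigenvalue :: "(int \<Rightarrow> complex) \<Rightarrow> nat \<Rightarrow> complex \<Rightarrow> complex" where
  "loop_eigenvalue \<sigma> d w =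
     (\<Sum>A\<in>{0..<int d}. of_int (int d - A) * \<sigma> A * ((w powi (A + 1) - w powi (- A)) / (w - 1)))"

text \<open>A Verlinde formula.  For \<open>g = 0\<close> it is the orthogonality of characters; each further
  loop multiplies every summand by its eigenvalue.\<close>

lemma weighted_count_eq:
  assumes c: "0 \<le> c" "c < int d"
  shows "weighted_count \<sigma> (int d) g c =
    - (\<Sum>w\<in>unity_roots (2 * d + 1). loop_eigenvalue \<sigma> d w ^ g * cos_increment c w) / (2 * of_nat (2 * d +
        1))"
  using c
proof (induction g arbitrary: c)
  case 0
  have s: "(\<Sum>w\<in>unity_roots (2 * d + 1). w powi k) = (if k = 0 then of_nat (2 * d + 1) else 0)"
      if "\<bar>k\<bar> < int (2 * d + 1)" for k
    using that by (rule sum_unity_roots_power_int)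
  have total: "(\<Sum>w\<in>unity_roots (2 * d + 1). cos_increment c w) =
      (if c = 0 then - (2 * of_nat (2 * d + 1)) else 0)"
    unfolding cos_increment_def using 0 by (simp only: sum.distrib sum_subtractf s) (simp add: s)
  have normalize: "- (if c = 0 then - (2 * N) else 0) / (2 * N) = (if c = 0 then 1 else 0)"
    if "N \<noteq> 0" for N :: complex
    using that by simp
  have "(of_nat (2 * d + 1) :: complex) \<noteq> 0" by (simp only: of_nat_eq_0_iff)
  note normalize[OF this]
  with total show ?case using weighted_count_0[OF 0] by (simp only: power_0 mult_1_left)
next
  case (Suc g)
  let ?p = "2 * d + 1"
  let ?K = "- 1 / (2 * of_nat ?p) :: complex"
  have IH: "weighted_count \<sigma> (int d) g k =
      ?K * (\<Sum>w\<in>unity_roots ?p. loop_eigenvalue \<sigma> d w ^ g * cos_increment k w)"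
    if "0 \<le> k" "k < int d" for k
    using Suc.IH[OF that] by simp
  let ?I = "\<lambda>A. {\<bar>c - A\<bar>..min (c + A) (2 * int d - 1 - c - A)}"
  have "weighted_count \<sigma> (int d) (Suc g) c =
    (\<Sum>A\<in>{0..<int d}. \<Sum>L\<in>{A..<int d}. \<Sum>k\<in>?I A. \<sigma> A * weighted_count \<sigma> (int d) g k)"
    using Suc.prems by (rule weighted_count_Suc)
  also have "\<dots> = (\<Sum>A\<in>{0..<int d}. of_int (int d - A) * (\<Sum>k\<in>?I A. \<sigma> A * weighted_count \<sigma> (int d) g k))"
    by (rule sum.cong) auto
  also have "\<dots> = (\<Sum>A\<in>{0..<int d}. \<Sum>w\<in>unity_roots ?p. ?K * (loop_eigenvalue \<sigma> d w ^ g *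
     (of_int (int d - A) * \<sigma> A * ((w powi (A + 1) - w powi (- A)) / (w - 1)) * cos_increment c w)))"
  proof (rule sum.cong)
    fix A assume A: "A \<in> {0..<int d}"
    have "(\<Sum>k\<in>?I A. \<sigma> A * weighted_count \<sigma> (int d) g k) =
       (\<Sum>k\<in>?I A. \<Sum>w\<in>unity_roots ?p. \<sigma> A * (?K * (loop_eigenvalue \<sigma> d w ^ g * cos_increment k w)))"
    proof (rule sum.cong)
      fix k assume "k \<in> ?I A"
      hence "0 \<le> k" "k < int d" using A Suc.prems by auto
      thus "\<sigma> A * weighted_count \<sigma> (int d) g k =
          (\<Sum>w\<in>unity_roots ?p. \<sigma> A * (?K * (loop_eigenvalue \<sigma> d w ^ g * cos_increment k w)))"
        by (simp only: IH sum_distrib_left)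
    qed simp
    also have "\<dots> =
        (\<Sum>w\<in>unity_roots ?p. \<sigma> A * (?K * (loop_eigenvalue \<sigma> d w ^ g * (\<Sum>k\<in>?I A. cos_increment k w))))"
      by (subst sum.swap) (simp only: sum_distrib_left)
    also have "\<dots> =
        (\<Sum>w\<in>unity_roots ?p. \<sigma> A * (?K * (loop_eigenvalue \<sigma> d w ^ g * ((w powi (A + 1) - w powi (- A)) /
            (w - 1) * cos_increment c w))))"
    proof (rule sum.cong)
      fix w assume "w \<in> unity_roots ?p"
      hence "(\<Sum>k\<in>?I A. cos_increment k w) = (w powi (A + 1) - w powi (- A)) / (w - 1) * cos_increment c w"
        by (intro fusion) (use A Suc.prems in \<open>auto simp: unity_roots_def\<close>)
      thus "\<sigma> A * (?K * (loop_eigenvalue \<sigma> d w ^ g * (\<Sum>k\<in>?I A. cos_increment k w))) =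
         \<sigma> A * (?K * (loop_eigenvalue \<sigma> d w ^ g * ((w powi (A + 1) - w powi (- A)) / (w - 1) *
             cos_increment c w)))"
        by (simp only:)
    qed simp
    finally show "of_int (int d - A) * (\<Sum>k\<in>?I A. \<sigma> A * weighted_count \<sigma> (int d) g k) =
       (\<Sum>w\<in>unity_roots ?p. ?K * (loop_eigenvalue \<sigma> d w ^ g *
     (of_int (int d - A) * \<sigma> A * ((w powi (A + 1) - w powi (- A)) / (w - 1)) * cos_increment c w)))"
      by (simp only: sum_distrib_left) (simp only: mult_ac)
  qed simp
  also have "\<dots> =
      (\<Sum>w\<in>unity_roots ?p. ?K * (loop_eigenvalue \<sigma> d w ^ g * (loop_eigenvalue \<sigma> d w * cos_increment c w)))"
    unfolding loop_eigenvalue_def by (subst sum.swap) (simp only: sum_distrib_left sum_distrib_right)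
  also have "\<dots> = ?K * (\<Sum>w\<in>unity_roots ?p. loop_eigenvalue \<sigma> d w ^ Suc g * cos_increment c w)"
    by (simp only: sum_distrib_left power_Suc mult_ac)
  finally show ?case by simp
qed

section \<open>The eigenvalues of the two transfer operators\<close>

lemma sum_quantum_unsigned:
  fixes w v :: complex
  assumes "w * v = 1"
  shows "(w - 1) * (\<Sum>a<D. w ^ Suc a - v ^ a) = w * (w ^ D + v ^ D - 2)"
proof (induction D)
  case (Suc D)
  have "w * v ^ Suc D = v ^ D" using assms by (simp add: mult.assoc[symmetric])
  thus ?case using Suc by (simp add: algebra_simps)
qed simp

text \<open>The weights \<open>D - a\<close> arise from summing the partial sums \<open>sum_quantum_unsigned\<close> over their length.\<close>

lemma sum_weighted_quantum_unsigned:
  fixes w v :: complex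
  assumes "w * v = 1"
  shows "(w - 1)\<^sup>2 * (\<Sum>a<D. (of_nat D - of_nat a) * (w ^ Suc a - v ^ a)) =
    w * (w ^ Suc D - w + 1 - v ^ D - 2 * of_nat D * (w - 1))"
proof (induction D)
  case (Suc D)
  have v: "w * v ^ Suc D = v ^ D" using assms by (simp add: mult.assoc[symmetric])
  have "(\<Sum>a<Suc D. (of_nat (Suc D) - of_nat a) * (w ^ Suc a - v ^ a)) =
     (\<Sum>a<D. (of_nat D - of_nat a) * (w ^ Suc a - v ^ a)) + (\<Sum>a<Suc D. w ^ Suc a - v ^ a)"
    by (simp add: algebra_simps sum.distrib sum_subtractf)
  hence "(w - 1)\<^sup>2 * (\<Sum>a<Suc D. (of_nat (Suc D) - of_nat a) * (w ^ Suc a - v ^ a)) =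
     (w - 1)\<^sup>2 * (\<Sum>a<D. (of_nat D - of_nat a) * (w ^ Suc a - v ^ a)) + (w - 1) * ((w - 1) * (\<Sum>a<Suc D. w
         ^ Suc a - v ^ a))"
    by (simp only: distrib_left power2_eq_square mult.assoc)
  also have "\<dots> = w * (w ^ Suc D - w + 1 - v ^ D - 2 * of_nat D * (w - 1))
      + (w - 1) * (w * (w ^ Suc D + v ^ Suc D - 2))"
    by (simp only: Suc.IH sum_quantum_unsigned[OF assms])
  also have "\<dots> =
      w * (w ^ Suc D - w + 1 - v ^ D - 2 * of_nat D * (w - 1) + (w * w ^ Suc D - w ^ Suc D + w * v ^ Suc
          D - v ^ Suc D - 2 * (w - 1)))"
    by (simp add: algebra_simps)
  also have "\<dots> = w * (w ^ Suc (Suc D) - w + 1 - v ^ Suc D - 2 * of_nat (Suc D) * (w - 1))"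
    unfolding v by (simp add: algebra_simps)
  finally show ?case .
qed simp

lemma sum_quantum_signed:
  fixes w v :: complex
  assumes "w * v = 1"
  shows "(1 + w) * (\<Sum>a<D. (- 1) ^ a * (w ^ Suc a - v ^ a)) = w * ((- v) ^ D - (- w) ^ D)"
proof (induction D)
  case (Suc D)
  have v: "w * (- v) ^ Suc D = - ((- v) ^ D)" using assms by (simp add: mult.assoc[symmetric])
  have "(1 + w) * (\<Sum>a<Suc D. (- 1) ^ a * (w ^ Suc a - v ^ a)) =
    w * ((- v) ^ D - (- w) ^ D) + (1 + w) * (w * (- w) ^ D - (- v) ^ D)"
    using Suc by (simp add: algebra_simps power_minus[of w] power_minus[of v])
  also have "\<dots> = w * (w * (- w) ^ D) - (- v) ^ D" by (simp add: algebra_simps)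
  also have "\<dots> = w * ((- v) ^ Suc D - (- w) ^ Suc D)"
    by (simp only: right_diff_distrib v) simp
  finally show ?case .
qed simp

lemma sum_weighted_quantum_signed:
  fixes w v :: complex
  assumes "w * v = 1"
  shows "(1 + w)\<^sup>2 * (\<Sum>a<D. (of_nat D - of_nat a) * ((- 1) ^ a * (w ^ Suc a - v ^ a))) =
    w * (w - 1 + (- v) ^ D + (- w) ^ Suc D)"
proof (induction D)
  case (Suc D)
  have v: "w * (- v) ^ Suc D = - ((- v) ^ D)" using assms by (simp add: mult.assoc[symmetric])
  let ?f = "\<lambda>a. (- 1) ^ a * (w ^ Suc a - v ^ a)"
  have "(\<Sum>a<Suc D. (of_nat (Suc D) - of_nat a) * ?f a) =
     (\<Sum>a<D. (of_nat D - of_nat a) * ?f a) + (\<Sum>a<Suc D. ?f a)"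
    by (simp add: ring_distribs sum.distrib sum_subtractf)
  moreover have "(1 + w)\<^sup>2 * (x + y) = (1 + w)\<^sup>2 * x + (1 + w) * ((1 + w) * y)" for x y
    by (simp add: power2_eq_square algebra_simps)
  ultimately have "(1 + w)\<^sup>2 * (\<Sum>a<Suc D. (of_nat (Suc D) - of_nat a) * ?f a) =
     (1 + w)\<^sup>2 * (\<Sum>a<D. (of_nat D - of_nat a) * ?f a) + (1 + w) * ((1 + w) * (\<Sum>a<Suc D. ?f a))"
    by (simp only:)
  also have "\<dots> = w * (w - 1 + (- v) ^ D + (- w) ^ Suc D) + (1 + w) * (w * ((- v) ^ Suc D - (- w) ^ Suc D))"
    by (simp only: Suc.IH sum_quantum_signed[OF assms])
  also have "\<dots> =
      w * (w - 1 + (- v) ^ D + (- w) ^ Suc D + ((- v) ^ Suc D - (- w) ^ Suc D + w * (- v) ^ Suc D - w *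
          (- w) ^ Suc D))"
    by (simp only: ring_distribs) (simp add: algebra_simps)
  also have "\<dots> = w * (w - 1 + (- v) ^ Suc D + (- w) ^ Suc (Suc D))"
    unfolding v by (simp add: algebra_simps)
  finally show ?case .
qed simp

abbreviation parity_sign :: "int \<Rightarrow> complex" where
  "parity_sign \<equiv> (\<lambda>a. if even a then 1 else - 1)"

lemma loop_eigenvalue_nat:
  "loop_eigenvalue \<sigma> d w = (\<Sum>a<d. (of_nat d - of_nat a) * (\<sigma> (int a) * (w ^ Suc a - inverse w ^ a)))
      / (w - 1)"
proof -
  have "loop_eigenvalue \<sigma> d w =
     (\<Sum>a<d. of_int (int d - int a) * \<sigma> (int a) * ((w powi (int a + 1) - w powi (- int a)) / (w - 1)))"
    unfolding loop_eigenvalue_def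
    by (rule sum.reindex_bij_witness[of _ int nat]) auto
  also have "\<dots> = (\<Sum>a<d. (of_nat d - of_nat a) * (\<sigma> (int a) * (w ^ Suc a - inverse w ^ a))) / (w - 1)"
    unfolding sum_divide_distrib
  proof (rule sum.cong)
    fix a
    have "w powi (int a + 1) = w ^ Suc a" using power_int_of_nat[of w "Suc a"] by (simp add: add.commute)
    moreover have "w powi (- int a) = inverse w ^ a" by (simp add: power_int_minus power_inverse)
    ultimately show "of_int (int d - int a) * \<sigma> (int a)
        * ((w powi (int a + 1) - w powi (- int a)) / (w - 1)) =
       (of_nat d - of_nat a) * (\<sigma> (int a) * (w ^ Suc a - inverse w ^ a)) / (w - 1)" by simp
  qed simp
  finally show ?thesis .
qed

text \<open>The relation that makes the boundary terms of the two geometric sums cancel at \<open>D = d\<close>.\<close>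

lemma root_half:
  fixes w :: complex
  assumes "w ^ (2 * d + 1) = 1"
  shows "w ^ Suc d = inverse w ^ d"
proof -
  have "w ^ Suc d * w ^ d = 1" using assms by (simp add: power_add[symmetric] mult_2 flip: power_Suc)
  thus ?thesis by (metis inverse_unique mult.commute power_inverse)
qed

text \<open>The boundary terms of the weighted sum cancel by \<open>root_half\<close>; what is left is
  \<open>p / (4 sin\<^sup>2 \<theta>)\<close> with \<open>p = 2 d + 1\<close>.\<close>

lemma loop_eigenvalue_unsigned:
  assumes w: "w \<in> unity_roots (2 * d + 1)" "w \<noteq> 1"
  shows "loop_eigenvalue (\<lambda>_. 1) d w = of_nat (2 * d + 1) / (4 * half_sin_sq w)"
proof -
  have w0: "w \<noteq> 0" using unity_roots_nonzero w by auto
  define S where "S = (\<Sum>a<d. (of_nat d - of_nat a) * (w ^ Suc a - inverse w ^ a))"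
  have "(w - 1)\<^sup>2 * S = w * (w ^ Suc d - w + 1 - inverse w ^ d - 2 * of_nat d * (w - 1))"
    unfolding S_def by (rule sum_weighted_quantum_unsigned) (use w0 in simp)
  also have "w ^ Suc d = inverse w ^ d" by (rule root_half) (use w in \<open>simp add: unity_roots_def\<close>)
  also have "w * (inverse w ^ d - w + 1 - inverse w ^ d - 2 * of_nat d * (w - 1)) =
      (w - 1) * (- w * of_nat (2 * d + 1))"
    by (simp add: algebra_simps)
  finally have "(w - 1) * ((w - 1) * S) = (w - 1) * (- w * of_nat (2 * d + 1))"
      by (simp only: power2_eq_square mult.assoc)
  moreover have "w - 1 \<noteq> 0" using w by simp
  ultimately have S: "(w - 1) * S = - w * of_nat (2 * d + 1)" using mult_left_cancel[THEN iffD1] by blast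
  have h: "4 * half_sin_sq w = - (w - 1)\<^sup>2 / w"
    using w0 by (simp add: half_sin_sq_def field_simps power2_eq_square)
  have "loop_eigenvalue (\<lambda>_. 1) d w = S / (w - 1)" by (simp add: loop_eigenvalue_nat S_def)
  also have "\<dots> = (w - 1) * S / (w - 1)\<^sup>2" using w by (simp add: power2_eq_square)
  also have "\<dots> = of_nat (2 * d + 1) / (4 * half_sin_sq w)"
    unfolding S h by simp
  finally show ?thesis .
qed

lemma neg_unity_root_neq: "w \<in> unity_roots (2 * d + 1) \<Longrightarrow> w \<noteq> - 1"
  by (auto simp: unity_roots_def)

text \<open>Again the boundary terms cancel, and \<open>1 / (4 cos\<^sup>2 \<theta>)\<close> remains.  The factor \<open>p\<close> of the
  unsigned eigenvalue is absent, so that the signed count has smaller degree.\<close>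

lemma loop_eigenvalue_signed:
  assumes w: "w \<in> unity_roots (2 * d + 1)" "w \<noteq> 1"
  shows "loop_eigenvalue parity_sign d w = 1 / (4 * half_sin_sq (- w))"
proof -
  have w0: "w \<noteq> 0" using unity_roots_nonzero w by auto
  have w1: "1 + w \<noteq> 0" using neg_unity_root_neq[OF w(1)] by (metis add.commute add_eq_0_iff)
  define S where "S = (\<Sum>a<d. (of_nat d - of_nat a) * ((- 1) ^ a * (w ^ Suc a - inverse w ^ a)))"
  have "(1 + w)\<^sup>2 * S = w * (w - 1 + (- inverse w) ^ d + (- w) ^ Suc d)"
    unfolding S_def by (rule sum_weighted_quantum_signed) (use w0 in simp)
  also have "(- w) ^ Suc d = - ((- inverse w) ^ d)"
  proof -
    have "w ^ Suc d = inverse w ^ d" by (rule root_half) (use w in \<open>simp add: unity_roots_def\<close>)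
    thus ?thesis by (simp add: power_minus[of "inverse w"] power_minus[of w])
  qed
  finally have S: "(1 + w)\<^sup>2 * S = w * (w - 1)" by simp
  have h: "4 * half_sin_sq (- w) = (1 + w)\<^sup>2 / w"
    using w0 by (simp add: half_sin_sq_def field_simps power2_eq_square)
  have sg: "(if even (int a) then 1 else - 1 :: complex) = (- 1) ^ a" for a by simp
  have "loop_eigenvalue parity_sign d w = S / (w - 1)"
    unfolding loop_eigenvalue_nat S_def sg ..
  also have "\<dots> = (1 + w)\<^sup>2 * S / ((1 + w)\<^sup>2 * (w - 1))" using w1 by simp
  also have "\<dots> = 1 / (4 * half_sin_sq (- w))"
    unfolding S h using w1 w by simp
  finally show ?thesis .
qed

section \<open>Weighted counts as combinations of power sums\<close>

abbreviation cpoly :: "rat poly \<Rightarrow> complex \<Rightarrow> complex" where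
  "cpoly P \<equiv> poly (map_poly of_rat P)"

lemma map_poly_of_rat_mult:
  "map_poly of_rat (P * Q) = map_poly of_rat P * (map_poly of_rat Q :: complex poly)"
  by (rule poly_eqI) (simp add: coeff_map_poly coeff_mult of_rat_sum of_rat_mult)

lemma map_poly_of_rat_add:
  "map_poly of_rat (P + Q) = map_poly of_rat P + (map_poly of_rat Q :: complex poly)"
  by (rule poly_eqI) (simp add: coeff_map_poly of_rat_add)

lemma map_poly_of_rat_diff:
  "map_poly of_rat (P - Q) = map_poly of_rat P - (map_poly of_rat Q :: complex poly)"
  by (rule poly_eqI) (simp add: coeff_map_poly of_rat_diff)

lemma cpoly_sum:
  assumes "degree P \<le> n"
  shows "cpoly P x = (\<Sum>i\<le>n. of_rat (coeff P i) * x ^ i)"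
proof -
  have "cpoly P x = (\<Sum>i\<le>degree P. of_rat (coeff P i) * x ^ i)"
    by (simp add: poly_altdef coeff_map_poly degree_map_poly)
  also have "\<dots> = (\<Sum>i\<le>n. of_rat (coeff P i) * x ^ i)"
    by (rule sum.mono_neutral_left) (use assms in \<open>auto simp: coeff_eq_0\<close>)
  finally show ?thesis .
qed

text \<open>The Chebyshev recursion for \<open>4 sin \<theta> sin ((2 n + 1) \<theta>)\<close>, where \<open>L\<close> stands for \<open>2 cos (2 \<theta>)\<close> and
  \<open>A\<close> for \<open>4 sin\<^sup>2 \<theta>\<close>.  It is used with \<open>L\<close> and \<open>A\<close> expressed by \<open>sin\<^sup>2 \<theta>\<close> in the unsigned case and by
  \<open>cos\<^sup>2 \<theta>\<close> in the signed case.\<close>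

fun spine_poly :: "rat poly \<Rightarrow> rat poly \<Rightarrow> nat \<Rightarrow> rat poly" where
  "spine_poly L A 0 = A"
| "spine_poly L A (Suc 0) = (L + 1) * A"
| "spine_poly L A (Suc (Suc n)) = L * spine_poly L A (Suc n) - spine_poly L A n"

lemma cpoly_spine_poly:
  assumes w: "w \<noteq> 0" and L: "cpoly L x = w + inverse w" and A: "cpoly A x = 2 - w - inverse w"
  shows "cpoly (spine_poly L A n) x = - cos_increment (int n) w"
  using assms
proof (induction L A n rule: spine_poly.induct)
  case 1
  then show ?case by (simp add: cos_increment_def power_int_minus)
next
  case 2
  then show ?case
    by (simp add: map_poly_of_rat_mult map_poly_of_rat_add cos_increment_def power_int_minus)
       (simp add: field_simps power2_eq_square)
next
  case (3 L A n)
  define P Q where "P = w ^ n" and "Q = inverse w ^ n"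
  have P: "w powi int n = P" "w powi (int n + 1) = w * P" "w powi (int n + 2) =
      w * w * P" "w powi (int n + 3) = w * w * w * P"
    using w by (simp_all add: P_def power_int_add power_numeral_reduce)
  have Q: "w powi (- int n) = Q" "w powi (- (int n + 1)) = inverse w * Q"
     "w powi (- (int n + 2)) = inverse w * inverse w * Q" "w powi (- (int n + 3)) =
         inverse w * inverse w * inverse w * Q"
    using w by (simp_all add: Q_def power_int_add power_int_minus power_int_diff power_numeral_reduce
      field_simps)
  have p: "cos_increment (int n) w = (w * P + inverse w * Q) - (P + Q)"
    "cos_increment (int n + 1) w = (w * w * P + inverse w * inverse w * Q) - (w * P + inverse w * Q)"
    "cos_increment (int n + 2) w = (w * w * w * P + inverse w * inverse w * inverse w * Q)
        - (w * w * P + inverse w * inverse w * Q)"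
    unfolding cos_increment_def using P Q by (simp_all add: add.assoc)
  have s: "int (Suc n) = int n + 1" "int (Suc (Suc n)) = int n + 2" by simp_all
  have "cpoly (spine_poly L A (Suc (Suc n))) x =
      (w + inverse w) * (- cos_increment (int n + 1) w) - (- cos_increment (int n) w)"
    using 3 unfolding spine_poly.simps s[symmetric] by (simp add: map_poly_of_rat_mult map_poly_of_rat_diff)
  also have "\<dots> = - cos_increment (int n + 2) w"
    unfolding p using w by (simp add: algebra_simps)
  finally show ?case unfolding s .
qed

lemma degree_spine_poly:
  assumes "degree L \<le> 1" "degree A \<le> 1"
  shows "degree (spine_poly L A n) \<le> n + 1"
  using assms
proof (induction L A n rule: spine_poly.induct)
  case (2 L A)
  have "degree (L + 1) \<le> 1" by (rule degree_add_le) (use 2 in auto)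
  thus ?case using degree_mult_le[of "L + 1" A] 2 by simp
next
  case (3 L A n)
  show ?case unfolding spine_poly.simps
    using 3 degree_mult_le[of L "spine_poly L A (Suc n)"] by (intro degree_diff_le) auto
qed simp

lemma coeff_spine_poly_unsigned:
  "coeff (spine_poly [:2, -4:] [:0, 4:] n) 0 = 0"
  "coeff (spine_poly [:2, -4:] [:0, 4:] n) 1 = 4 * (2 * of_nat n + 1)"
proof -
  have "coeff (spine_poly L A n) 0 = 0 \<and> coeff (spine_poly L A n) 1 = 4 * (2 * of_nat n + 1)"
    if "L = [:2, -4:]" "A = [:0, 4:]" for L A
    using that by (induction L A n rule: spine_poly.induct) (simp_all add: algebra_simps)
  thus "coeff (spine_poly [:2, -4:] [:0, 4:] n) 0 = 0"
    "coeff (spine_poly [:2, -4:] [:0, 4:] n) 1 = 4 * (2 * of_nat n + 1)" by blast+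
qed

lemma cos_increment_1 [simp]: "cos_increment c 1 = 0"
  by (simp add: cos_increment_def)

text \<open>The index \<open>i = 0\<close> would lead to the power sum of order \<open>g\<close>, but its coefficient vanishes by
  \<open>coeff_spine_poly_unsigned\<close>; so \<open>i = 1\<close> is the dominant term.\<close>

lemma weighted_count_unsigned:
  assumes c: "c < d" and g: "g > 0"
  defines "t \<equiv> coeff (spine_poly [:2, -4:] [:0, 4:] c)"
  shows "weighted_count (\<lambda>_. 1) (int d) g (int c) =
    (\<Sum>i\<le>c + 1. of_rat (t i / (2 * 4 ^ g)) * of_nat (2 * d + 1) ^ (g - 1) * csc_power_sum (int g - int i)
        (2 * d + 1))"
proof -
  define p where "p = 2 * d + 1"
  define N where "N = (of_nat p :: complex)"
  have N0: "N \<noteq> 0" unfolding N_def p_def by (simp only: of_nat_eq_0_iff)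
  have fin: "finite (unity_roots p)" by (simp add: p_def)
  have "(\<Sum>w\<in>unity_roots p. loop_eigenvalue (\<lambda>_. 1) d w ^ g * cos_increment (int c) w) =
    (\<Sum>w\<in>unity_roots p - {1}. loop_eigenvalue (\<lambda>_. 1) d w ^ g * cos_increment (int c) w)"
    by (rule sum.mono_neutral_right) (use fin in auto)
  also have "\<dots> =
      (\<Sum>w\<in>unity_roots p - {1}. - (\<Sum>i\<le>c + 1. of_rat (t i) * N ^ g / 4 ^ g * half_sin_sq w powi (- (int g -
          int i))))"
  proof (rule sum.cong)
    fix w assume w: "w \<in> unity_roots p - {1}"
    hence w0: "w \<noteq> 0" using unity_roots_nonzero[of w p] by (auto simp: p_def)
    hence s0: "half_sin_sq w \<noteq> 0" using w by (auto simp: half_sin_sq_eq_0_iff)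
    have 1: "loop_eigenvalue (\<lambda>_. 1) d w = N / (4 * half_sin_sq w)"
      unfolding N_def p_def using w by (intro loop_eigenvalue_unsigned) (auto simp: p_def)
    have "- cos_increment (int c) w = cpoly (spine_poly [:2, -4:] [:0, 4:] c) (half_sin_sq w)"
      by (rule cpoly_spine_poly[symmetric])
         (use w0 in \<open>auto simp: half_sin_sq_def map_poly_pCons of_rat_minus field_simps\<close>)
    also have "\<dots> = (\<Sum>i\<le>c + 1. of_rat (t i) * half_sin_sq w ^ i)"
      unfolding t_def by (rule cpoly_sum, rule degree_spine_poly) auto
    finally have 2: "cos_increment (int c) w = - (\<Sum>i\<le>c + 1. of_rat (t i) * half_sin_sq w ^ i)"
      by (metis minus_minus)
    show "loop_eigenvalue (\<lambda>_. 1) d w ^ g * cos_increment (int c) w =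
      - (\<Sum>i\<le>c + 1. of_rat (t i) * N ^ g / 4 ^ g * half_sin_sq w powi (- (int g - int i)))"
      unfolding 1 2 mult_minus_right sum_distrib_left
      using s0 by (simp add: power_int_diff power_divide power_mult_distrib mult_ac)
  qed simp
  also have "\<dots> = - (\<Sum>i\<le>c + 1. of_rat (t i) * N ^ g / 4 ^ g * csc_power_sum (int g - int i) p)"
    unfolding sum_negf csc_power_sum_def sum_distrib_left by (subst sum.swap) simp
  finally have "(\<Sum>w\<in>unity_roots p. loop_eigenvalue (\<lambda>_. 1) d w ^ g * cos_increment (int c) w) =
     - (\<Sum>i\<le>c + 1. of_rat (t i) * N ^ g / 4 ^ g * csc_power_sum (int g - int i) p)" .
  moreover have "weighted_count (\<lambda>_. 1) (int d) g (int c) =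
    - (\<Sum>w\<in>unity_roots p. loop_eigenvalue (\<lambda>_. 1) d w ^ g * cos_increment (int c) w) / (2 * N)"
    unfolding p_def N_def by (rule weighted_count_eq) (use c in auto)
  ultimately have "weighted_count (\<lambda>_. 1) (int d) g (int c) =
    (\<Sum>i\<le>c + 1. of_rat (t i) * N ^ g / 4 ^ g * csc_power_sum (int g - int i) p) / (2 * N)" by simp
  also have "\<dots> = (\<Sum>i\<le>c + 1. of_rat (t i / (2 * 4 ^ g)) * N ^ (g - 1) * csc_power_sum (int g - int i) p)"
    unfolding sum_divide_distrib
    by (rule sum.cong) (use N0 g in \<open>cases g; simp add: of_rat_divide of_rat_mult of_rat_power\<close>)+
  finally show ?thesis unfolding N_def p_def .
qed

text \<open>For odd \<open>p\<close> the \<open>2 p\<close>-th roots of unity are the \<open>p\<close>-th ones and their negatives.\<close>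

lemma sum_negative_unity_roots:
  assumes p: "odd p"
  shows "(\<Sum>w\<in>unity_roots p. half_sin_sq (- w) powi (- m)) = csc_power_sum m (2 * p) - csc_power_sum m p"
proof -
  have p0: "p > 0" using p by (rule odd_pos)
  have fin: "finite (unity_roots p)" using p0 by simp
  have u: "unity_roots (2 * p) - {1} = (unity_roots p - {1}) \<union> uminus ` unity_roots p"
  proof (rule set_eqI)
    fix w :: complex
    have "w \<in> unity_roots (2 * p) \<longleftrightarrow> (w ^ p)\<^sup>2 = 1"
      by (simp add: unity_roots_def power_mult mult.commute)
    also have "\<dots> \<longleftrightarrow> w \<in> unity_roots p \<or> - w \<in> unity_roots p"
      using p by (simp add: unity_roots_def power2_eq_1_iff minus_equation_iff)  (metis minus_minus)
    finally have "w \<in> unity_roots (2 * p) \<longleftrightarrow> w \<in> unity_roots p \<or> w \<in> uminus ` unity_roots p"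
      by (metis image_iff minus_minus)
    moreover have "1 \<notin> uminus ` unity_roots p"
    proof
      assume "1 \<in> uminus ` unity_roots p"
      hence "(- 1 :: complex) \<in> unity_roots p" by (metis image_iff minus_minus)
      thus False using p by (simp add: unity_roots_def)
    qed
    ultimately show "w \<in> unity_roots (2 * p) - {1} \<longleftrightarrow> w \<in> (unity_roots p - {1}) \<union> uminus ` unity_roots p"
      by auto
  qed
  have dis: "(unity_roots p - {1}) \<inter> uminus ` unity_roots p = {}"
    using p by (auto simp: unity_roots_def)
  have "csc_power_sum m (2 * p) = csc_power_sum m p + (\<Sum>w\<in>uminus ` unity_roots p. half_sin_sq w powi (- m))"
    unfolding csc_power_sum_def u by (rule sum.union_disjoint) (use fin dis in auto)
  also have "(\<Sum>w\<in>uminus ` unity_roots p. half_sin_sq w powi (- m)) =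
      (\<Sum>w\<in>unity_roots p. half_sin_sq (- w) powi (- m))"
    by (subst sum.reindex) (auto simp: inj_on_def)
  finally show ?thesis by simp
qed

lemma weighted_count_signed:
  assumes c: "c < d"
  defines "t \<equiv> coeff (spine_poly [:-2, 4:] [:4, -4:] c)"
  shows "weighted_count parity_sign (int d) g (int c) =
    (\<Sum>i\<le>c + 1. of_rat (t i / (2 * 4 ^ g)) *
      (csc_power_sum (int g - int i) (2 * (2 * d + 1)) - csc_power_sum (int g - int i) (2 * d + 1))) /
          of_nat (2 * d + 1)"
proof -
  define p where "p = 2 * d + 1"
  define N where "N = (of_nat p :: complex)"
  let ?l = "loop_eigenvalue parity_sign d"
  have "(\<Sum>w\<in>unity_roots p. ?l w ^ g * cos_increment (int c) w) =
     (\<Sum>w\<in>unity_roots p. - (\<Sum>i\<le>c + 1. of_rat (t i) / 4 ^ g * half_sin_sq (- w) powi (- (int g - int i))))"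
  proof (rule sum.cong)
    fix w assume w: "w \<in> unity_roots p"
    hence w0: "w \<noteq> 0" using unity_roots_nonzero[of w p] by (auto simp: p_def)
    have s0: "half_sin_sq (- w) \<noteq> 0"
      using neg_unity_root_neq[of w d] w w0 half_sin_sq_eq_0_iff[of "- w"] unfolding p_def
        by (metis minus_minus neg_0_equal_iff_equal)
    \<comment> \<open>At \<open>w = 1\<close> the eigenvalue formula fails, but the other factor is zero.\<close>
    have 1: "?l w ^ g * cos_increment (int c) w =
        (1 / (4 * half_sin_sq (- w))) ^ g * cos_increment (int c) w"
      using loop_eigenvalue_signed[of w d] w by (cases "w = 1") (simp_all add: p_def)
    have "- cos_increment (int c) w = cpoly (spine_poly [:-2, 4:] [:4, -4:] c) (half_sin_sq (- w))"
      by (rule cpoly_spine_poly[symmetric])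
         (use w0 in \<open>auto simp: half_sin_sq_def map_poly_pCons of_rat_minus field_simps\<close>)
    also have "\<dots> = (\<Sum>i\<le>c + 1. of_rat (t i) * half_sin_sq (- w) ^ i)"
      unfolding t_def by (rule cpoly_sum, rule degree_spine_poly) auto
    finally have 2: "cos_increment (int c) w = - (\<Sum>i\<le>c + 1. of_rat (t i) * half_sin_sq (- w) ^ i)"
      by (metis minus_minus)
    show "?l w ^ g * cos_increment (int c) w =
      - (\<Sum>i\<le>c + 1. of_rat (t i) / 4 ^ g * half_sin_sq (- w) powi (- (int g - int i)))"
      unfolding 1 unfolding 2 mult_minus_right sum_distrib_left
      using s0 by (simp add: power_int_diff power_divide power_mult_distrib mult_ac)
  qed simp
  also have "\<dots> =
      - (\<Sum>i\<le>c + 1. of_rat (t i) / 4 ^ g * (\<Sum>w\<in>unity_roots p. half_sin_sq (- w) powi (- (int g - int i))))"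
    unfolding sum_negf sum_distrib_left by (subst sum.swap) simp
  also have "\<dots> =
      - (\<Sum>i\<le>c + 1. of_rat (t i) / 4 ^ g * (csc_power_sum (int g - int i) (2 * p) - csc_power_sum (int g -
          int i) p))"
    by (subst sum_negative_unity_roots) (simp_all add: p_def)
  finally have "(\<Sum>w\<in>unity_roots p. ?l w ^ g * cos_increment (int c) w) =
     - (\<Sum>i\<le>c + 1. of_rat (t i) / 4 ^ g * (csc_power_sum (int g - int i) (2 * p) - csc_power_sum (int g -
         int i) p))" .
  moreover have "weighted_count parity_sign (int d) g (int c) =
    - (\<Sum>w\<in>unity_roots p. ?l w ^ g * cos_increment (int c) w) / (2 * N)"
    unfolding p_def N_def by (rule weighted_count_eq) (use c in auto)
  ultimately have "weighted_count parity_sign (int d) g (int c) =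
    (\<Sum>i\<le>c + 1. of_rat (t i) / 4 ^ g * (csc_power_sum (int g - int i) (2 * p) - csc_power_sum (int g - int
        i) p)) / (2 * N)" by simp
  also have "\<dots> =
      (\<Sum>i\<le>c + 1. of_rat (t i / (2 * 4 ^ g)) * (csc_power_sum (int g - int i) (2 * p) - csc_power_sum (int
          g - int i) p)) / N"
    unfolding sum_divide_distrib
    by (rule sum.cong) (simp_all add: of_rat_divide of_rat_mult of_rat_power)
  finally show ?thesis unfolding N_def p_def .
qed

section \<open>Degrees and leading coefficients of the counts\<close>

text \<open>The term of \<open>i \<ge> 1\<close> has degree at most \<open>(g - 1) + 2 (g - i)\<close>, or at most \<open>g\<close> if
  \<open>i \<ge> g\<close>.  For \<open>g \<ge> 3\<close> only \<open>i = 1\<close> reaches \<open>3 g - 3\<close>.\<close>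

lemma weighted_count_unsigned_poly:
  assumes g: "g \<ge> 3"
  shows "\<exists>N :: rat poly. degree N \<le> 3 * g - 3 \<and>
     coeff N (3 * g - 3) = (2 * of_nat c + 1) * bernoulli_tilde (g - 1) \<and>
     (\<forall>d>c. weighted_count (\<lambda>_. 1) (int d) g (int c) = of_rat (poly N (of_nat (2 * d + 1))))"
proof -
  have "\<forall>m. \<exists>F :: rat poly. (\<forall>n. n > 0 \<and> int n > - m \<longrightarrow> csc_power_sum m n = of_rat (poly F (of_nat n))) \<and>
     degree F \<le> max 1 (nat (2 * m)) \<and>
     (m > 0 \<longrightarrow> coeff F (nat (2 * m)) = 2 * 4 ^ nat m * bernoulli_tilde (nat m))"
    using csc_power_sum_poly by blast
  then obtain F where F: "\<And>m n. n > 0 \<Longrightarrow> int n > - m \<Longrightarrow> csc_power_sum m n = of_rat (poly (F m) (of_nat n))"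
    and dF: "\<And>m. degree (F m) \<le> max 1 (nat (2 * m))"
    and lF: "\<And>m. m > 0 \<Longrightarrow> coeff (F m) (nat (2 * m)) = 2 * 4 ^ nat m * bernoulli_tilde (nat m)"
    unfolding choice_iff by blast
  define t where "t = coeff (spine_poly [:2, -4:] [:0, 4:] c)"
  define N where "N = (\<Sum>i\<le>c + 1. smult (t i / (2 * 4 ^ g)) (monom 1 (g - 1) * F (int g - int i)))"
  have t: "t 0 = 0" "t 1 = 4 * (2 * of_nat c + 1)" unfolding t_def by (rule coeff_spine_poly_unsigned)+
  have dM: "degree (monom 1 (g - 1) * F (int g - int i)) \<le> (g - 1) + max 1 (nat (2 * (int g - int i)))"
      for i
    by (rule order.trans[OF degree_mult_le]) (use dF[of "int g - int i"] in \<open>simp add: degree_monom_eq\<close>)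
  have small: "degree (monom 1 (g - 1) * F (int g - int i)) < 3 * g - 3" if "i \<ge> 2" for i
  proof -
    have "nat (2 * (int g - int i)) \<le> 2 * g - 4" "1 \<le> 2 * g - 4"
      using that g by (auto simp: nat_le_iff of_nat_diff)
    hence "max 1 (nat (2 * (int g - int i))) \<le> 2 * g - 4" by simp
    thus ?thesis using dM[of i] g by linarith
  qed
  have deg1: "degree (monom 1 (g - 1) * F (int g - int 1)) \<le> 3 * g - 3"
  proof -
    have "max 1 (nat (2 * (int g - int 1))) \<le> 2 * g - 2" using g by (auto simp: nat_le_iff of_nat_diff)
    thus ?thesis using dM[of 1] g by linarith
  qed
  have "degree N \<le> 3 * g - 3"
    unfolding N_def
  proof (rule degree_sum_le)
    fix i assume "i \<in> {..c + 1}"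
    consider "i = 0" | "i = 1" | "i \<ge> 2" by linarith
    thus "degree (smult (t i / (2 * 4 ^ g)) (monom 1 (g - 1) * F (int g - int i))) \<le> 3 * g - 3"
      using t(1) small[of i] deg1 by cases (auto intro: order.trans[OF degree_smult_le])
  qed simp
  moreover have "coeff N (3 * g - 3) = (2 * of_nat c + 1) * bernoulli_tilde (g - 1)"
  proof -
    have z: "t i / (2 * 4 ^ g) * coeff (monom 1 (g - 1) * F (int g - int i)) (3 * g - 3) = 0" if "i \<noteq> 1"
        for i
    proof (cases "i = 0")
      case False
      hence "i \<ge> 2" using that by simp
      from coeff_eq_0[OF small[OF this]] show ?thesis by simp
    qed (simp add: t)
    have "coeff N (3 * g - 3) =
        (\<Sum>i\<le>c + 1. t i / (2 * 4 ^ g) * coeff (monom 1 (g - 1) * F (int g - int i)) (3 * g - 3))"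
      by (simp only: N_def coeff_sum coeff_smult)
    also have "\<dots> = (\<Sum>i\<in>{1}. t i / (2 * 4 ^ g) * coeff (monom 1 (g - 1) * F (int g - int i)) (3 * g - 3))"
      by (rule sum.mono_neutral_right) (use z in auto)
    also have "\<dots> = t 1 / (2 * 4 ^ g) * coeff (monom 1 (g - 1) * F (int g - 1)) (3 * g - 3)" by simp
    also have "coeff (monom 1 (g - 1) * F (int g - 1)) (3 * g - 3) =
        coeff (F (int g - 1)) (nat (2 * (int g - 1)))"
    proof -
      have "3 * g - 3 - (g - 1) = nat (2 * (int g - 1))" "g - 1 \<le> 3 * g - 3" using g by auto
      thus ?thesis by (simp add: coeff_monom_mult)
    qed
    also have "\<dots> = 2 * 4 ^ (g - 1) * bernoulli_tilde (g - 1)"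
    proof -
      have "nat (int g - 1) = g - 1" by simp
      thus ?thesis using lF[of "int g - 1"] g by simp
    qed
    also have "t 1 / (2 * 4 ^ g) * (2 * 4 ^ (g - 1) * bernoulli_tilde (g - 1)) =
        (2 * of_nat c + 1) * bernoulli_tilde (g - 1)"
      unfolding t using g by (cases g) simp_all
    finally show ?thesis .
  qed
  moreover have "weighted_count (\<lambda>_. 1) (int d) g (int c) = of_rat (poly N (of_nat (2 * d + 1)))"
      if "d > c" for d
  proof -
    have "weighted_count (\<lambda>_. 1) (int d) g (int c) =
      (\<Sum>i\<le>c + 1. of_rat (t i / (2 * 4 ^ g)) * of_nat (2 * d + 1) ^ (g - 1) * csc_power_sum (int g - int
          i) (2 * d + 1))"
      unfolding t_def by (rule weighted_count_unsigned) (use that g in auto)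
    also have "\<dots> =
        (\<Sum>i\<le>c + 1. of_rat (t i / (2 * 4 ^ g) * (of_nat (2 * d + 1) ^ (g - 1) * poly (F (int g - int i))
            (of_nat (2 * d + 1)))))"
    proof (rule sum.cong)
      fix i assume "i \<in> {..c + 1}"
      hence "csc_power_sum (int g - int i) (2 * d + 1) =
          of_rat (poly (F (int g - int i)) (of_nat (2 * d + 1)))"
        by (intro F) (use that g in auto)
      thus "of_rat (t i / (2 * 4 ^ g)) * of_nat (2 * d + 1) ^ (g - 1)
          * csc_power_sum (int g - int i) (2 * d + 1) =
        of_rat (t i / (2 * 4 ^ g) * (of_nat (2 * d + 1) ^ (g - 1) * poly (F (int g - int i)) (of_nat (2 *
            d + 1))))"
        by (simp only: of_rat_mult of_rat_power of_rat_of_nat_eq mult.assoc)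
    qed simp
    also have "\<dots> = of_rat (poly N (of_nat (2 * d + 1)))"
      by (simp only: N_def poly_sum poly_smult poly_mult poly_monom of_rat_sum mult_1_left)
    finally show ?thesis .
  qed
  ultimately show ?thesis by blast
qed

lemma poly_doubling_difference:
  fixes F :: "rat poly"
  shows "\<exists>H. degree H \<le> degree F - 1 \<and> (\<forall>x. poly F (2 * x) - poly F x = x * poly H x)"
proof -
  define G where "G = pcompose F [:0, 2:] - F"
  obtain a H where H: "G = pCons a H" by (cases G) auto
  have "poly G 0 = 0" by (simp add: G_def poly_pcompose)
  hence a: "a = 0" by (simp add: H)
  have "degree G \<le> degree F"
    unfolding G_def by (rule degree_diff_le) (auto intro: order.trans[OF degree_pcompose_le])
  hence "degree H \<le> degree F - 1" by (cases "H = 0") (auto simp: H)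
  moreover have "poly F (2 * x) - poly F x = x * poly H x" for x
  proof -
    have "poly G x = x * poly H x" by (simp add: H a)
    thus ?thesis by (simp add: G_def poly_pcompose mult.commute)
  qed
  ultimately show ?thesis by blast
qed

text \<open>Each difference of power sums is a polynomial in \<open>p\<close> of degree at most \<open>2 g\<close>, and one factor
  \<open>p\<close> is cancelled by the normalization.\<close>

lemma weighted_count_signed_poly:
  assumes g: "g \<ge> 3"
  shows "\<exists>M :: rat poly. degree M < 3 * g - 3 \<and>
     (\<forall>d>c. weighted_count parity_sign (int d) g (int c) = of_rat (poly M (of_nat (2 * d + 1))))"
proof -
  have "\<exists>H :: rat poly. degree H \<le> max 1 (nat (2 * m)) - 1 \<and>
    (\<forall>n. n > 0 \<and> int n > - m \<longrightarrow> csc_power_sum m (2 * n) - csc_power_sum m n = of_nat n * of_rat (poly H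
        (of_nat n)))" for m
  proof -
    obtain F :: "rat poly" where F: "\<And>n. n > 0 \<Longrightarrow> int n > - m \<Longrightarrow> csc_power_sum m n =
        of_rat (poly F (of_nat n))"
      and dF: "degree F \<le> max 1 (nat (2 * m))"
      using csc_power_sum_poly[of m] by blast
    obtain H where H: "degree H \<le> degree F - 1" "\<And>x. poly F (2 * x) - poly F x = x * poly H x"
      using poly_doubling_difference[of F] by blast
    have "csc_power_sum m (2 * n) - csc_power_sum m n = of_nat n * of_rat (poly H (of_nat n))"
        if "n > 0" "int n > - m" for n
    proof -
      have "csc_power_sum m (2 * n) - csc_power_sum m n = of_rat (poly F (of_nat (2 * n)))
          - of_rat (poly F (of_nat n))"
        using F[of n] F[of "2 * n"] that by simp
      also have "\<dots> = of_rat (poly F (2 * of_nat n) - poly F (of_nat n))" by (simp add: of_rat_diff)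
      also have "\<dots> = of_nat n * of_rat (poly H (of_nat n))" unfolding H(2) by (simp add: of_rat_mult)
      finally show ?thesis .
    qed
    moreover have "degree H \<le> max 1 (nat (2 * m)) - 1" using H(1) dF by linarith
    ultimately show ?thesis by blast
  qed
  hence "\<forall>m. \<exists>H :: rat poly. degree H \<le> max 1 (nat (2 * m)) - 1 \<and>
    (\<forall>n. n > 0 \<and> int n > - m \<longrightarrow> csc_power_sum m (2 * n) - csc_power_sum m n = of_nat n * of_rat (poly H
        (of_nat n)))"
    by blast
  then obtain H where dH: "\<And>m. degree (H m) \<le> max 1 (nat (2 * m)) - 1"
    and H: "\<And>m n. n > 0 \<Longrightarrow> int n > - m \<Longrightarrow> csc_power_sum m (2 * n) - csc_power_sum m n =
        of_nat n * of_rat (poly (H m) (of_nat n))"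
    unfolding choice_iff by blast
  define t where "t = coeff (spine_poly [:-2, 4:] [:4, -4:] c)"
  define M where "M = (\<Sum>i\<le>c + 1. smult (t i / (2 * 4 ^ g)) (H (int g - int i)))"
  have "degree M \<le> 2 * g - 1"
    unfolding M_def
  proof (rule degree_sum_le)
    fix i assume "i \<in> {..c + 1}"
    have "nat (2 * (int g - int i)) \<le> 2 * g" "1 \<le> 2 * g"
      using g by (auto simp: nat_le_iff)
    hence "max 1 (nat (2 * (int g - int i))) \<le> 2 * g" by simp
    hence "degree (H (int g - int i)) \<le> 2 * g - 1" using dH[of "int g - int i"] by linarith
    thus "degree (smult (t i / (2 * 4 ^ g)) (H (int g - int i))) \<le> 2 * g - 1"
      by (rule order.trans[OF degree_smult_le])
  qed simp
  hence "degree M < 3 * g - 3" using g by linarith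
  moreover have "weighted_count parity_sign (int d) g (int c) = of_rat (poly M (of_nat (2 * d + 1)))"
    if "d > c" for d
  proof -
    define p where "p = 2 * d + 1"
    have p0: "(of_nat p :: complex) \<noteq> 0" unfolding p_def by (simp only: of_nat_eq_0_iff)
    have "weighted_count parity_sign (int d) g (int c) =
       (\<Sum>i\<le>c + 1. of_rat (t i / (2 * 4 ^ g)) * (csc_power_sum (int g - int i) (2 * p) - csc_power_sum
           (int g - int i) p)) / of_nat p"
      unfolding t_def p_def by (rule weighted_count_signed[OF that])
    also have "\<dots> =
        (\<Sum>i\<le>c + 1. of_rat (t i / (2 * 4 ^ g)) * (csc_power_sum (int g - int i) (2 * p) - csc_power_sum
            (int g - int i) p) / of_nat p)"
      by (rule sum_divide_distrib)
    also have "\<dots> = (\<Sum>i\<le>c + 1. of_rat (t i / (2 * 4 ^ g) * poly (H (int g - int i)) (of_nat p)))"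
    proof (rule sum.cong)
      fix i assume "i \<in> {..c + 1}"
      hence h: "csc_power_sum (int g - int i) (2 * p) - csc_power_sum (int g - int i) p =
          of_nat p * of_rat (poly (H (int g - int i)) (of_nat p))"
        by (intro H) (use that g in \<open>auto simp: p_def\<close>)
      show "of_rat (t i / (2 * 4 ^ g)) * (csc_power_sum (int g - int i) (2 * p)
          - csc_power_sum (int g - int i) p) / of_nat p =
         of_rat (t i / (2 * 4 ^ g) * poly (H (int g - int i)) (of_nat p))"
        unfolding h of_rat_mult using p0 by simp
    qed simp
    also have "\<dots> = of_rat (poly M (of_nat p))"
      by (simp only: M_def poly_sum poly_smult of_rat_sum)
    finally show ?thesis unfolding p_def .
  qed
  ultimately show ?thesis by blast
qed

lemma prod_parity_sign:
  "(\<Prod>i\<in>I. if even (a i) then 1 else - 1) = (if even (\<Sum>i\<in>I. a i :: int) then 1 else - 1 :: complex)"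
  if "finite I"
  using that by (induction I rule: finite_induct) auto

text \<open>Both sides sum over the colorings; a coloring contributes \<open>(1 \<plusminus> sign) / 2\<close>.\<close>

lemma parity_counts:
  assumes "p = 2 * d + 1"
  shows "(of_nat (num_even_colorings p g c) :: complex) =
      (weighted_count (\<lambda>_. 1) (int d) g (int c) + (- 1) ^ c * weighted_count parity_sign (int d) g (int
          c)) / 2"
    and "(of_nat (num_odd_colorings p g c) :: complex) =
      (weighted_count (\<lambda>_. 1) (int d) g (int c) - (- 1) ^ c * weighted_count parity_sign (int d) g (int
          c)) / 2"
proof -
  define S where "S = spine_colorings (int d) g (int c)"
  have S: "lollipop_colorings p g c = S" unfolding S_def lollipop_colorings_eq using assms by simp
  have fin: "finite S" using finite_lollipop_colorings[of p g c] S by simp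
  let ?s = "\<lambda>(a, l :: nat \<Rightarrow> int, k :: nat \<Rightarrow> int). int c + (\<Sum>i = 1..g. a i)"
  have w1: "weighted_count (\<lambda>_. 1) (int d) g (int c) = (\<Sum>x\<in>S. 1)"
    by (simp add: weighted_count_def S_def split_def)
  have w2: "(- 1) ^ c * weighted_count parity_sign (int d) g (int c) =
      (\<Sum>x\<in>S. if even (?s x) then 1 else - 1)"
    unfolding weighted_count_def S_def[symmetric] sum_distrib_left
    by (rule sum.cong) (auto simp: prod_parity_sign)
  have e: "num_even_colorings p g c = card {x \<in> S. even (?s x)}"
    unfolding num_even_colorings_def S by (rule arg_cong[where f = card]) auto
  have o: "num_odd_colorings p g c = card {x \<in> S. odd (?s x)}"
    unfolding num_odd_colorings_def S by (rule arg_cong[where f = card]) auto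
  have card: "of_nat (card {x \<in> S. P x}) = (\<Sum>x\<in>S. if P x then 1 else 0 :: complex)" for P
    using fin by (simp add: sum.If_cases Int_def)
  show "(of_nat (num_even_colorings p g c) :: complex) =
      (weighted_count (\<lambda>_. 1) (int d) g (int c) + (- 1) ^ c * weighted_count parity_sign (int d) g (int
          c)) / 2"
    unfolding e card w1 w2 sum.distrib[symmetric] sum_divide_distrib by (rule sum.cong) auto
  show "(of_nat (num_odd_colorings p g c) :: complex) =
      (weighted_count (\<lambda>_. 1) (int d) g (int c) - (- 1) ^ c * weighted_count parity_sign (int d) g (int
          c)) / 2"
    unfolding o card w1 w2 sum_subtractf[symmetric] sum_divide_distrib by (rule sum.cong) auto
qed

theorem corollary2p10:
  fixes g c :: nat
  assumes "g \<ge> 3"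
  shows "(\<exists>E :: rat poly.
            degree E = 3 * g - 3 \<and>
            lead_coeff E = (of_nat c + 1 / 2) * bernoulli_tilde (g - 1) \<and>
            (\<forall>p :: nat. prime p \<and> p \<ge> 5 \<and> p \<ge> 2 * c + 3 \<longrightarrow>
               of_nat (num_even_colorings p g c) = poly E (of_nat p))) \<and>
         (\<exists>Q :: rat poly.
            degree Q = 3 * g - 3 \<and>
            lead_coeff Q = (of_nat c + 1 / 2) * bernoulli_tilde (g - 1) \<and>
            (\<forall>p :: nat. prime p \<and> p \<ge> 5 \<and> p \<ge> 2 * c + 3 \<longrightarrow>
               of_nat (num_odd_colorings p g c) = poly Q (of_nat p)))"
proof -
  obtain N :: "rat poly" where dN: "degree N \<le> 3 * g - 3"
    and lN: "coeff N (3 * g - 3) = (2 * of_nat c + 1) * bernoulli_tilde (g - 1)"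
    and N: "\<And>d. d > c \<Longrightarrow> weighted_count (\<lambda>_. 1) (int d) g (int c) = of_rat (poly N (of_nat (2 * d + 1)))"
    using weighted_count_unsigned_poly[OF assms, of c] by blast
  obtain M :: "rat poly" where dM: "degree M < 3 * g - 3"
    and M: "\<And>d. d > c \<Longrightarrow> weighted_count parity_sign (int d) g (int c) = of_rat (poly M (of_nat (2 * d + 1)))"
    using weighted_count_signed_poly[OF assms, of c] by blast
  have half: "degree R = 3 * g - 3 \<and> lead_coeff R = (of_nat c + 1 / 2) * bernoulli_tilde (g - 1)"
    if R: "R = smult (1 / 2) (N + smult s M)" for R s
  proof -
    have "degree (smult s M) \<le> 3 * g - 3" using degree_smult_le[of s M] dM by linarith
    hence d: "degree R \<le> 3 * g - 3"
      unfolding R using dN by (blast intro: order.trans[OF degree_smult_le] degree_add_le)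
    have l: "coeff R (3 * g - 3) = (of_nat c + 1 / 2) * bernoulli_tilde (g - 1)"
      using coeff_eq_0[OF dM]
      by (simp only: R lN coeff_smult coeff_add) (simp add: field_simps)
    have "bernoulli_tilde (g - 1) \<noteq> 0" using bernoulli_tilde_pos[of "g - 1"] assms by simp
    moreover have "of_nat c + 1 / 2 > (0 :: rat)" by (simp add: add_nonneg_pos)
    ultimately have "coeff R (3 * g - 3) \<noteq> 0" unfolding l by simp
    hence "degree R = 3 * g - 3" using d le_degree[of R] by (intro antisym) blast+
    thus ?thesis using l by simp
  qed
  have count: "of_nat (num_even_colorings p g c) =
      poly (smult (1 / 2) (N + smult ((- 1) ^ c) M)) (of_nat p) \<and>
       of_nat (num_odd_colorings p g c) = poly (smult (1 / 2) (N + smult (- ((- 1) ^ c)) M)) (of_nat p)"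
    if p: "prime p \<and> p \<ge> 5 \<and> p \<ge> 2 * c + 3" for p
  proof -
    have "odd p" using p prime_odd_nat[of p] by auto
    then obtain d where d: "p = 2 * d + 1" by (metis oddE)
    have "d > c" using p d by simp
    note e = parity_counts[OF d, of g c, unfolded N[OF this] M[OF this], folded d]
    have "(of_rat (of_nat (num_even_colorings p g c)) :: complex) =
        of_rat (poly (smult (1 / 2) (N + smult ((- 1) ^ c) M)) (of_nat p))"
      using e(1) by (simp add: of_rat_mult of_rat_add of_rat_divide of_rat_power of_rat_minus)
    moreover have "(of_rat (of_nat (num_odd_colorings p g c)) :: complex) =
        of_rat (poly (smult (1 / 2) (N + smult (- ((- 1) ^ c)) M)) (of_nat p))"
      using e(2) by (simp add: of_rat_mult of_rat_diff of_rat_divide of_rat_power of_rat_minus)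
    ultimately show ?thesis by (simp only: of_rat_eq_iff)
  qed
  show ?thesis using half count by blast
qed

end
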